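(* The following formulas are true: (i) $\displaystyle 2\log 2 = 1+\sum_{n=1}^{\infty}\frac{4n+1}{(2n)(2n+1)}\binom{2n}{n}^2\frac{1}{2^{4n}}$; (ii) $\displaystyle 3\log 2 = 2+\sum_{n=1}^{\infty}\frac{6n+1}{(2n)(2n+1)}\binom{2n}{n}^2\frac{1}{2^{6n}}$; (iii) $\displaystyle 8\log 2 = \frac{11}{2}+\sum_{n=1}^{\infty}\frac{15n+2}{(2n)(2n+1)}\binom{2n}{n}^2\frac{1}{2^{8n}}$. Furthermore, formula (ii) is equivalent to $4\,m(2)=m(8)$, and formula (iii) is equivalent to $11\,m(1)=m(16)$ (so that both of these Mahler measure identities hold).
   Context: For a nonzero Laurent polynomial $P(x_1,\dots,x_N)$ with complex coefficients, the (logarithmic) Mahler measure is $\operatorname{m}(P):=\int_0^1\cdots\int_0^1\log\left|P(e^{2\pi i\theta_1},\dots,e^{2\pi i\theta_N})\right|\,d\theta_1\cdots d\theta_N$. For $\alpha\in\mathbb{R}$, $m(\alpha):=\operatorname{m}\left(\alpha+x+\frac1x+y+\frac1y\right)$, the Mahler measure of this Laurent polynomial in the two variables $x,y$. *)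

theory Defs
  imports "HOL-Analysis.Analysis" "HOL-Library.Poly_Mapping"
begin

text \<open>
  Complex Laurent polynomials in variables indexed by natural numbers: finitely supported maps
  from exponent vectors (with integer entries) to coefficients. An \<open>N\<close>-variable polynomial
  uses the indices \<open>0, \<dots>, N - 1\<close>.
\<close>

type_synonym laurent_poly = "(nat \<Rightarrow>\<^sub>0 int) \<Rightarrow>\<^sub>0 complex"

definition laurent_eval :: "laurent_poly \<Rightarrow> (nat \<Rightarrow> complex) \<Rightarrow> complex" where
  "laurent_eval P x =
     (\<Sum>e\<in>Poly_Mapping.keys P. Poly_Mapping.lookup P e *
        (\<Prod>i\<in>Poly_Mapping.keys e. x i powi Poly_Mapping.lookup e i))"

text \<open>
  The iterated Lebesgue integral over \<open>[0,1]\<^sup>N\<close>, with the variable of index \<open>0\<close> innermost.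
  The coordinates of index at least \<open>N\<close> of the argument of \<open>F\<close> are set to \<open>0\<close>.
\<close>

primrec iterated_integral :: "nat \<Rightarrow> ((nat \<Rightarrow> real) \<Rightarrow> real) \<Rightarrow> real" where
  "iterated_integral 0 F = F (\<lambda>_. 0)"
| "iterated_integral (Suc N) F =
     (LBINT t:{0..1}. iterated_integral N (\<lambda>\<theta>. F (\<theta>(N := t))))"

text \<open>
  The integrand is \<open>-\<infinity>\<close> at zeros of \<open>P\<close> on the torus, where \<^term>\<open>ln (0::real)\<close> is \<open>0\<close>;
  for nonzero \<open>P\<close> these form a null set, so the integral is not affected.
\<close>

definition mahler_measure :: "nat \<Rightarrow> laurent_poly \<Rightarrow> real" where
  "mahler_measure N P =
     iterated_integral N (\<lambda>\<theta>. ln (cmod (laurent_eval P (\<lambda>j. exp (2 * pi * \<i> * \<theta> j)))))"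

definition laurent_const :: "complex \<Rightarrow> laurent_poly" where
  "laurent_const c = Poly_Mapping.single 0 c"

definition var_pow :: "nat \<Rightarrow> int \<Rightarrow> laurent_poly" where
  "var_pow i k = Poly_Mapping.single (Poly_Mapping.single i k) 1"

definition family_poly :: "real \<Rightarrow> laurent_poly" where
  "family_poly \<alpha> =
     laurent_const (complex_of_real \<alpha>) + var_pow 0 1 + var_pow 0 (-1) + var_pow 1 1 + var_pow 1 (-1)"

definition mahler_m :: "real \<Rightarrow> real" where
  "mahler_m \<alpha> = mahler_measure 2 (family_poly \<alpha>)"

lemma laurent_eval_eq_sum:
  assumes "finite S" "Poly_Mapping.keys P \<subseteq> S"
  shows "laurent_eval P x = (\<Sum>e\<in>S. Poly_Mapping.lookup P e *
        (\<Prod>i\<in>Poly_Mapping.keys e. x i powi Poly_Mapping.lookup e i))"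
  unfolding laurent_eval_def using assms
  by (intro sum.mono_neutral_left) (auto simp: in_keys_iff)

lemma laurent_eval_add: "laurent_eval (P + Q) x = laurent_eval P x + laurent_eval Q x"
proof -
  let ?S = "Poly_Mapping.keys P \<union> Poly_Mapping.keys Q"
  have "Poly_Mapping.keys (P + Q) \<subseteq> ?S" by (rule Poly_Mapping.keys_add)
  then show ?thesis
    by (simp add: laurent_eval_eq_sum[of ?S] lookup_add distrib_right sum.distrib)
qed

lemma laurent_eval_family_poly:
  "laurent_eval (family_poly \<alpha>) x = \<alpha> + x 0 + 1 / x 0 + x 1 + 1 / x 1"
proof -
  have "laurent_eval (laurent_const c) x = c" for c
    by (cases "c = 0") (simp_all add: laurent_eval_def laurent_const_def)
  moreover have "laurent_eval (var_pow i k) x = x i powi k" for i k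
    by (cases "k = 0") (simp_all add: laurent_eval_def var_pow_def)
  ultimately show ?thesis
    by (simp add: family_poly_def laurent_eval_add power_int_minus field_simps)
qed

lemma mahler_m_eq:
  "mahler_m \<alpha> = (LBINT t:{0..1}. LBINT s:{0..1}.
     ln (cmod (\<alpha> + exp (2 * pi * \<i> * of_real s) + 1 / exp (2 * pi * \<i> * of_real s)
       + exp (2 * pi * \<i> * of_real t) + 1 / exp (2 * pi * \<i> * of_real t))))"
  by (simp add: mahler_m_def mahler_measure_def laurent_eval_family_poly numeral_2_eq_2)

definition series_term :: "nat \<Rightarrow> nat \<Rightarrow> nat \<Rightarrow> nat \<Rightarrow> real" where
  "series_term a b k n =
     (real a * real n + real b) / ((2 * real n) * (2 * real n + 1))
       * (real ((2 * n) choose n))\<^sup>2 * (1 / 2 ^ (k * n))"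

end

theory Submission
  imports Defs "HOL-Real_Asymp.Real_Asymp"
begin

text \<open>
  Each series is summed with a Wilf--Zeilberger pair,
  \<open>F N k - F (N+1) k = G N (k+1) - G N k\<close>: the row sums \<open>T N = (\<Sum>k. F N k)\<close> satisfy
  \<open>T N - T (N+1) = - G N 0\<close> and tend to \<open>0\<close>, so \<open>(\<Sum>N. - G N 0) = T 0\<close>. For (i) and (ii)
  the series in question is \<open>T 0\<close> (up to the factor 2), while \<open>G N 0\<close> is a rational function of
  \<open>N\<close> whose sum is a combination of digamma values; the pairs are the \<open>a\<close>-shift of the derivative
  at \<open>c = 0\<close> of Dougall's \<open>5F4\<close> sum, and of Gosper's strange \<open>5F4(1/4)\<close> sum. For (iii) the roles are
  exchanged: the terms of the series are \<open>- G N 0\<close>, and \<open>T 0\<close> is a rational series. The pair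
  arises from an acceleration of Dougall's \<open>5H5\<close> sum.

  For the Mahler measures, \<open>\<alpha> + x + 1/x + y + 1/y\<close> becomes \<open>\<alpha> + 4 cos u cos v\<close> on the torus. Jensen's
  formula removes one variable, and the remaining integral is expanded into powers of \<open>(4/\<alpha>)\<^sup>2\<close>
  for \<open>\<alpha> > 4\<close> and of \<open>(\<alpha>/4)\<^sup>2\<close> for \<open>\<alpha> < 4\<close>. Then \<open>4 m(2) - m(8)\<close> and \<open>11 m(1) - m(16)\<close>
  are the defects in (ii) and (iii), up to a factor.
\<close>

section \<open>Wilf--Zeilberger pairs and the three series\<close>

text \<open>The pairs (2, 8) and (1, 16) have the form (4k, 4/k) with k = 1/2 and k = 1/4. For such
  a pair both expansions run in powers of the same k^2 and share the coefficient
  \<open>cbinom n\<close> squared: the rational factor is k/(2n+1) for m(4k) and 1/(2n) for ln(4/k)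
  - m(4/k). The linear numerators come from combining the two: (6n+1)/(2n(2n+1)) = 4 * (1/2)/(2n+1)
  + 1/(2n), and (15n+2)/(2n(2n+1)) = 22 * (1/4)/(2n+1) + 2/(2n). The terms n = 0 of the first
  expansion become the constants 2 and 11/2. Formula (i) has the shape of the same combination at k
  = 1, where both parameters equal 4.

  The analytic obstacle is \<alpha> < 4. There the polynomial vanishes on the torus, so the
  integrand has logarithmic singularities: exchanging the integrals requires control of its negative
  part, and after Jensen's formula the remaining integrand obeys different formulas on different
  arcs.\<close>

lemma wz_sums:
  fixes F G :: "nat \<Rightarrow> nat \<Rightarrow> real"
  assumes pair: "\<And>N k. F N k - F (Suc N) k = G N (Suc k) - G N k"
    and summ: "\<And>N. summable (F N)"
    and G0: "\<And>N. G N \<longlonglongrightarrow> 0"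
    and T0: "(\<lambda>N. suminf (F N)) \<longlonglongrightarrow> 0"
  shows "(\<lambda>N. - G N 0) sums suminf (F 0)"
proof -
  have "suminf (F N) - suminf (F (Suc N)) = - G N 0" for N
  proof -
    have "(\<lambda>k. F N k - F (Suc N) k) sums (suminf (F N) - suminf (F (Suc N)))"
      by (intro sums_diff summable_sums summ)
    moreover have "(\<lambda>k. F N k - F (Suc N) k) sums (0 - G N 0)"
      unfolding pair by (rule telescope_sums[OF G0])
    ultimately have "suminf (F N) - suminf (F (Suc N)) = 0 - G N 0" by (rule sums_unique2)
    then show ?thesis by simp
  qed
  with telescope_sums'[OF T0] show ?thesis by simp
qed

section \<open>Normalised central binomial coefficients\<close>

text \<open>This is binom(2n, n) / 4^n. The same numbers are the coefficients of 1 / sqrt (1 - x)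
  and the means of the even powers of the sine, which is how their squares enter the Mahler
  measures. The Pochhammer form is the one that shifts well in the WZ pairs.\<close>

definition cbinom :: "nat \<Rightarrow> real" where
  "cbinom n = pochhammer (1/2) n / fact n"

lemma cbinom_0 [simp]: "cbinom 0 = 1" by (simp add: cbinom_def)

lemma cbinom_Suc: "cbinom (Suc n) = cbinom n * ((2 * real n + 1) / (2 * real n + 2))"
  by (simp add: cbinom_def pochhammer_rec' field_simps)

lemma cbinom_pos: "cbinom n > 0"
  by (induction n) (auto simp: cbinom_Suc intro!: mult_pos_pos divide_pos_pos)

lemma cbinom_le_1: "cbinom n \<le> 1"
proof (induction n)
  case (Suc n)
  then show ?case
    unfolding cbinom_Suc using cbinom_pos[of n] by (intro mult_le_one) auto
qed simp

text \<open>The inductive step comes down to (2n+1)(2n+3) \<le> (2n+2)^2. The decay is essential for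
  (i), whose terms have no geometric factor: it makes them of order 1/n^2.\<close>

lemma cbinom_sq_le: "(cbinom n)\<^sup>2 \<le> 1 / (2 * real n + 1)"
proof (induction n)
  case (Suc n)
  have "(cbinom (Suc n))\<^sup>2 = (cbinom n)\<^sup>2 * ((2 * real n + 1) / (2 * real n + 2))\<^sup>2"
    by (simp only: cbinom_Suc power_mult_distrib)
  also have "\<dots> \<le> 1 / (2 * real n + 1) * ((2 * real n + 1) / (2 * real n + 2))\<^sup>2"
    by (rule mult_right_mono[OF Suc]) simp
  also have "\<dots> = (2 * real n + 1) / (2 * real n + 2)\<^sup>2"
    by (simp add: power2_eq_square divide_simps)
  also have "\<dots> \<le> 1 / (2 * real (Suc n) + 1)"
    by (simp add: power2_eq_square divide_simps) (simp add: algebra_simps)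
  finally show ?case .
qed simp

lemma central_binomial_eq_cbinom: "real ((2 * n) choose n) = 4 ^ n * cbinom n"
proof -
  have "real ((2 * n) choose n) = fact (2 * n) / (fact n * fact n)"
    by (simp add: binomial_fact mult_2)
  also have "fact (2 * n) = (4 ^ n * pochhammer (1/2) n * fact n :: real)"
    using fact_double[of n, where 'a = real] by (simp add: power_mult)
  finally show ?thesis by (simp add: cbinom_def)
qed

lemma series_term_eq_cbinom:
  "series_term a b k n = (real a * real n + real b) / ((2 * real n) * (2 * real n + 1))
      * (cbinom n)\<^sup>2 * (16 / 2 ^ k) ^ n"
proof -
  have *: "(4 ^ n)\<^sup>2 * (1 / 2 ^ (k * n)) = ((16 / 2 ^ k) ^ n :: real)"
  proof -
    have "(4 ^ n)\<^sup>2 = (16 ^ n :: real)"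
      by (simp add: power2_eq_square power_mult_distrib[symmetric])
    then show ?thesis by (simp add: power_divide power_mult)
  qed
  have "x * (4 ^ n * c)\<^sup>2 * y = x * c\<^sup>2 * ((4 ^ n)\<^sup>2 * y)" for x c y :: real
    unfolding power_mult_distrib by (simp only: mult_ac)
  then show ?thesis
    unfolding series_term_def central_binomial_eq_cbinom by (simp only: *)
qed

section \<open>The hypergeometric weight of the first two pairs\<close>

text \<open>The square of \<open>cbinom k\<close> with its factorial moved up by \<open>N\<close>. A
  unit step in either variable multiplies it by the square of a rational function, as a WZ pair
  requires.\<close>

definition wz_weight :: "nat \<Rightarrow> nat \<Rightarrow> real" where
  "wz_weight N k = (pochhammer (1/2) k / pochhammer (real N + 1) k)\<^sup>2"

lemma wz_weight_Suc_right:
  "wz_weight N (Suc k) = wz_weight N k * ((real k + 1/2) / (real N + 1 + real k))\<^sup>2"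
  unfolding wz_weight_def pochhammer_rec' times_divide_times_eq[symmetric] power_mult_distrib
  by (simp add: add_ac)

lemma wz_weight_Suc_left:
  "wz_weight (Suc N) k = wz_weight N k * ((real N + 1) / (real N + 1 + real k))\<^sup>2"
proof -
  have "(real N + 1) * pochhammer (real (Suc N) + 1) k = (real N + 1 + real k) * pochhammer (real N + 1) k"
    using pochhammer_rec[of "real N + 1" k] pochhammer_rec'[of "real N + 1" k]
    by (simp add: add_ac)
  then have *: "pochhammer (real (Suc N) + 1) k
      = (real N + 1 + real k) * pochhammer (real N + 1) k / (real N + 1)"
    by (simp only: eq_divide_eq) (auto simp: mult.commute)
  show ?thesis
    unfolding wz_weight_def * by (simp add: power_divide power_mult_distrib)
qed

lemma wz_weight_nonneg: "wz_weight N k \<ge> 0" by (simp add: wz_weight_def)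

lemma wz_weight_0_left: "wz_weight 0 k = (cbinom k)\<^sup>2"
  by (simp add: wz_weight_def cbinom_def pochhammer_fact)

text \<open>The first factor of the product, at index 0, supplies 1/(N+1)^2 exactly; every later
  factor only shrinks as \<open>N\<close> grows. The index \<open>Suc k\<close> is needed because
  the weight at index 0 is 1 for all \<open>N\<close>.\<close>

lemma wz_weight_le: "wz_weight N (Suc k) \<le> wz_weight 0 (Suc k) / (real N + 1)\<^sup>2"
proof (induction k)
  case 0
  have "(2 * real N + 2)\<^sup>2 = 4 * (real N + 1)\<^sup>2" by (simp add: power2_eq_square algebra_simps)
  then show ?case by (simp add: wz_weight_Suc_right wz_weight_def power_divide)
next
  case (Suc k)
  have "wz_weight N (Suc (Suc k)) = wz_weight N (Suc k) * ((real (Suc k) + 1/2) / (real N + 1 + real (Suc k)))\<^sup>2"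
    by (rule wz_weight_Suc_right)
  also have "\<dots> \<le> wz_weight 0 (Suc k) / (real N + 1)\<^sup>2 * ((real (Suc k) + 1/2) / (real 0 + 1 + real (Suc k)))\<^sup>2"
    by (intro mult_mono Suc power_mono divide_left_mono)
       (auto simp: wz_weight_nonneg intro!: mult_pos_pos)
  also have "\<dots> = wz_weight 0 (Suc (Suc k)) / (real N + 1)\<^sup>2"
    by (simp only: wz_weight_Suc_right[of 0 "Suc k"]) simp
  finally show ?case .
qed

lemma wz_weight_tendsto_0: "wz_weight N \<longlonglongrightarrow> 0"
proof -
  have "(\<lambda>k. wz_weight N (Suc k)) \<longlonglongrightarrow> 0"
  proof (rule tendsto_sandwich[of "\<lambda>_. 0"])
    show "\<forall>\<^sub>F k in sequentially. wz_weight N (Suc k) \<le> 1 / (2 * real (Suc k) + 1)"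
    proof (intro always_eventually allI)
      fix k
      have "wz_weight N (Suc k) \<le> wz_weight 0 (Suc k) / (real N + 1)\<^sup>2" by (rule wz_weight_le)
      also have "\<dots> \<le> wz_weight 0 (Suc k) / 1"
        by (intro divide_left_mono) (auto simp: wz_weight_nonneg)
      also have "\<dots> \<le> 1 / (2 * real (Suc k) + 1)"
        using cbinom_sq_le[of "Suc k"] by (simp add: wz_weight_0_left)
      finally show "wz_weight N (Suc k) \<le> 1 / (2 * real (Suc k) + 1)" .
    qed
    show "(\<lambda>k. 1 / (2 * real (Suc k) + 1)) \<longlonglongrightarrow> 0" by real_asymp
  qed (auto simp: wz_weight_nonneg)
  then show ?thesis by (rule LIMSEQ_offset[where k = 1, simplified])
qed

text \<open>One domination serves twice: it makes every row summable, and it bounds the row sums by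
  a multiple of 1/(N+1)^2, so that they vanish in the limit.\<close>

lemma wz_sums_dominated:
  fixes F G :: "nat \<Rightarrow> nat \<Rightarrow> real"
  assumes pair: "\<And>N k. F N k - F (Suc N) k = G N (Suc k) - G N k"
    and nonneg: "\<And>N k. F N k \<ge> 0"
    and bound: "\<And>N k. F N k \<le> F 0 k / (real N + 1)\<^sup>2"
    and summ: "summable (F 0)"
    and G0: "\<And>N. G N \<longlonglongrightarrow> 0"
  shows "(\<lambda>N. - G N 0) sums suminf (F 0)"
proof (rule wz_sums[where F = F and G = G, OF pair _ G0])
  have s: "summable (F N)" for N
    by (rule summable_comparison_test'[where g = "\<lambda>k. F 0 k / (real N + 1)\<^sup>2" and N = 0])
       (use summ nonneg bound in auto)
  then show "summable (F N)" for N .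
  show "(\<lambda>N. suminf (F N)) \<longlonglongrightarrow> 0"
  proof (rule tendsto_sandwich[of "\<lambda>_. 0"])
    show "\<forall>\<^sub>F N in sequentially. 0 \<le> suminf (F N)"
      by (intro always_eventually allI suminf_nonneg s nonneg)
    show "\<forall>\<^sub>F N in sequentially. suminf (F N) \<le> suminf (F 0) / (real N + 1)\<^sup>2"
      using suminf_le[OF bound s] summ
      by (auto simp: suminf_divide[symmetric] intro!: summable_divide)
    have "(\<lambda>N. 1 / (real N + 1)\<^sup>2) \<longlonglongrightarrow> 0" by real_asymp
    then show "(\<lambda>N. suminf (F 0) / (real N + 1)\<^sup>2) \<longlonglongrightarrow> 0"
      using tendsto_mult_right_zero[of _ sequentially "suminf (F 0)"] by fastforce
  qed simp
qed

text \<open>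
  In the three certificates \<open>T\<close> stands for the hypergeometric part of the summand, so that only an
  identity of rational functions is left.
\<close>

lemma wz_certificate1:
  fixes x n T :: real
  assumes "x > 0" "n \<ge> 0"
  shows "(1 / x + 1 / (x + n + 1/2)) * T - (1 / x + 1 / (x + n + 3/2)) * (T * ((n + 1) / (n + 1 + x))\<^sup>2)
    = - (T * ((x + 1/2) / (n + 1 + x))\<^sup>2 * (4 * n + 2 + 2 * (x + 1)) / ((2 * n + 1) * (x + n + 3/2)))
      - - (T * (4 * n + 2 + 2 * x) / ((2 * n + 1) * (x + n + 1/2)))"
proof -
  define A B c d u v w where "A = 2*x + 2*n + 1" and "B = 2*x + 2*n + 3" and "c = n + 1 + x" and "d = 2*n + 1"
    and "u = 2*x + 1" and "v = 2*n + 1 + x" and "w = 2*n + 2 + x"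
  note defs = A_def B_def c_def d_def u_def v_def w_def
  have nz: "x \<noteq> 0" "A \<noteq> 0" "B \<noteq> 0" "c \<noteq> 0" "d \<noteq> 0" using assms by (auto simp: defs)
  have lin: "x + n + 1/2 = A/2" "x + n + 3/2 = B/2" "n + 1 + x = c" "2 * n + 1 = d" "x + 1/2 = u/2"
    "4 * n + 2 + 2 * (x + 1) = 2 * w" "4 * n + 2 + 2 * x = 2 * v"
    by (simp_all add: defs field_simps)
  \<comment> \<open>Over common denominators the left side carries \<open>x\<close> and the right
    side carries \<open>d\<close>. The exchange works because the numerator times \<open>d\<close>
    is divisible by \<open>x\<close>. The doubled variables above keep this identity free of
    fractions. In the next certificate \<open>B\<close> plays the role of \<open>d\<close>.\<close>
  have key: "d * ((A + 2*x) * B * c\<^sup>2 - (B + 2*x) * A * (n + 1)\<^sup>2) = x * (4 * v * B * c\<^sup>2 - u\<^sup>2 * w * A)"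
    unfolding defs by (simp add: algebra_simps power2_eq_square)
  have "(1 / x + 1 / (A/2)) * T - (1 / x + 1 / (B/2)) * (T * ((n + 1) / c)\<^sup>2)
      = T * ((A + 2*x) * B * c\<^sup>2 - (B + 2*x) * A * (n + 1)\<^sup>2) / (x * A * B * c\<^sup>2)"
    using nz by (simp add: field_simps)
  also have "\<dots> = T * (d * ((A + 2*x) * B * c\<^sup>2 - (B + 2*x) * A * (n + 1)\<^sup>2)) / (d * (x * A * B * c\<^sup>2))"
    using nz by simp
  also have "\<dots> = T * (4 * v * B * c\<^sup>2 - u\<^sup>2 * w * A) / (d * A * B * c\<^sup>2)"
    unfolding key using nz by simp
  also have "\<dots> = - (T * ((u/2) / c)\<^sup>2 * (2 * w) / (d * (B/2))) - - (T * (2 * v) / (d * (A/2)))"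
    using nz by (simp add: field_simps power2_eq_square)
  finally show ?thesis unfolding lin .
qed

lemma wz_certificate2:
  fixes x n T :: real
  assumes "x > 0" "n \<ge> 0"
  shows "(2 * n + 1/2 + 3 * x) / (x * (2 * n + 1/2 + x)) * T
      - (2 * n + 5/2 + 3 * x) / (x * (2 * n + 5/2 + x)) * (T * ((n + 1) / (n + 1 + x))\<^sup>2)
    = - (T * ((x + 1/2) / (n + 1 + x))\<^sup>2 / 4 * (8 * n + 4 + 4 * (x + 1)) / ((2 * n + 3/2 + x) * (2 * n + 5/2 + x)))
      - - (T * (8 * n + 4 + 4 * x) / ((2 * n + 1/2 + x) * (2 * n + 3/2 + x)))"
proof -
  define A B D c u v w where "A = 4*n + 1 + 2*x" and "B = 4*n + 3 + 2*x" and "D = 4*n + 5 + 2*x"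
    and "c = n + 1 + x" and "u = 2*x + 1" and "v = 2*n + 1 + x" and "w = 2*n + 2 + x"
  note defs = A_def B_def c_def D_def u_def v_def w_def
  have nz: "x \<noteq> 0" "A \<noteq> 0" "B \<noteq> 0" "c \<noteq> 0" "D \<noteq> 0" using assms by (auto simp: defs)
  have lin: "2 * n + 1/2 + x = A/2" "2 * n + 3/2 + x = B/2" "2 * n + 5/2 + x = D/2" "n + 1 + x = c" "x + 1/2 = u/2"
    "8 * n + 4 + 4 * (x + 1) = 4 * w" "8 * n + 4 + 4 * x = 4 * v"
    "2 * n + 1/2 + 3 * x = (A + 4*x)/2" "2 * n + 5/2 + 3 * x = (D + 4*x)/2"
    by (simp_all add: defs field_simps)
  have key: "B * ((A + 4*x) * D * c\<^sup>2 - (D + 4*x) * A * (n + 1)\<^sup>2) = x * (16 * v * D * c\<^sup>2 - u\<^sup>2 * w * A)"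
    unfolding defs by (simp add: algebra_simps power2_eq_square)
  have "(A + 4*x)/2 / (x * (A/2)) * T - (D + 4*x)/2 / (x * (D/2)) * (T * ((n + 1) / c)\<^sup>2)
      = T * ((A + 4*x) * D * c\<^sup>2 - (D + 4*x) * A * (n + 1)\<^sup>2) / (x * A * D * c\<^sup>2)"
    using nz by (simp add: field_simps)
  also have "\<dots> = T * (B * ((A + 4*x) * D * c\<^sup>2 - (D + 4*x) * A * (n + 1)\<^sup>2)) / (B * (x * A * D * c\<^sup>2))"
    using nz by simp
  also have "\<dots> = T * (16 * v * D * c\<^sup>2 - u\<^sup>2 * w * A) / (A * B * D * c\<^sup>2)"
    unfolding key using nz by simp
  also have "\<dots> = - (T * ((u/2) / c)\<^sup>2 / 4 * (4 * w) / (B/2 * (D/2))) - - (T * (4 * v) / (A/2 * (B/2)))"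
    using nz by (simp add: field_simps power2_eq_square)
  finally show ?thesis unfolding lin .
qed

lemma wz_certificate3:
  fixes x n T :: real
  assumes "x \<ge> 0" "n > 0"
  defines "p \<equiv> \<lambda>x. ((15 * n + 2) * (n + 1/2)\<^sup>2 + (17 * n\<^sup>2 + 25/2 * n + 2) * x + (7 * n + 5/2) * x\<^sup>2 + x^3) / n"
  shows "4 * T / (x + n + 1/2) - 4 * (T * (n + 1/2)^4 * (1 / ((x + 2*n + 1) * (x + 2*n + 2)))\<^sup>2) / (x + n + 3/2)
    = - (T * ((x + 1) / (x + 2*n + 1))\<^sup>2 * p (x + 1) / ((x + 2*n + 2)\<^sup>2 * (x + n + 3/2)))
      - - (T * p x / ((x + 2*n + 1)\<^sup>2 * (x + n + 1/2)))"
proof -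
  define A B c d M where "A = 2*x + 2*n + 1" and "B = 2*x + 2*n + 3" and "c = x + 2*n + 1" and "d = x + 2*n + 2"
    and "M = 2*n + 1"
  define Q where "Q z = (15*n + 2) * (2*n + 1)\<^sup>2 + (68*n\<^sup>2 + 50*n + 8) * z + (28*n + 10) * z\<^sup>2 + 4 * z^3" for z
  note defs = A_def B_def c_def d_def M_def
  have nz: "n \<noteq> 0" "A \<noteq> 0" "B \<noteq> 0" "c \<noteq> 0" "d \<noteq> 0" using assms by (auto simp: defs)
  have lin: "x + n + 1/2 = A/2" "x + n + 3/2 = B/2" "x + 2 * n + 1 = c" "x + 2 * n + 2 = d" "n + 1/2 = M/2"
    by (simp_all add: defs field_simps)
  have p: "p z = Q z / (4 * n)" for z
    using nz by (simp add: p_def Q_def field_simps power2_eq_square)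
  have key: "n * (16 * c\<^sup>2 * d\<^sup>2 * B - M^4 * A) = Q x * d\<^sup>2 * B - (x + 1)\<^sup>2 * Q (x + 1) * A"
    unfolding defs Q_def by (simp add: algebra_simps power2_eq_square power3_eq_cube power4_eq_xxxx)
  have "4 * T / (A/2) - 4 * (T * (M/2)^4 * (1 / (c * d))\<^sup>2) / (B/2)
      = T * (16 * c\<^sup>2 * d\<^sup>2 * B - M^4 * A) / (2 * A * B * c\<^sup>2 * d\<^sup>2)"
    using nz by (simp add: field_simps)
  also have "\<dots> = T * (n * (16 * c\<^sup>2 * d\<^sup>2 * B - M^4 * A)) / (n * (2 * A * B * c\<^sup>2 * d\<^sup>2))"
    using nz by simp
  also have "\<dots> = - (T * ((x + 1) / c)\<^sup>2 * (Q (x + 1) / (4 * n)) / (d\<^sup>2 * (B/2)))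
      - - (T * (Q x / (4 * n)) / (c\<^sup>2 * (A/2)))"
  proof -
    define y q0 q1 where "y = x + 1" and "q0 = Q x" and "q1 = Q (x + 1)"
    show ?thesis unfolding key unfolding q1_def[symmetric] q0_def[symmetric] y_def[symmetric]
      using nz by (simp add: field_simps power2_eq_square)
  qed
  finally show ?thesis unfolding p lin .
qed

section \<open>Rational series with digamma values\<close>

lemma Digamma_sums:
  fixes z :: real
  assumes "z > 0"
  shows "(\<lambda>k. 1 / (real k + 1) - 1 / (real k + z)) sums (Digamma z + euler_mascheroni)"
proof -
  have "(\<lambda>k. inverse (real (Suc k)) - inverse (z + real k)) sums (Digamma z + euler_mascheroni)"
    using summable_sums[OF summable_Digamma[of z]] assms by (simp add: Digamma_def)
  then show ?thesis by (simp add: divide_inverse add_ac)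
qed

lemma digamma_half_sums: "(\<lambda>k. 1 / (real k + 1/2) - 1 / (real k + 1)) sums (2 * ln 2)"
  using sums_minus[OF Digamma_sums[of "1/2"]] Digamma_half_integer[of 0, where 'a = real] by simp

lemma digamma_three_halves_sums: "(\<lambda>k. 1 / (real k + 3/2) - 1 / (real k + 1)) sums (2 * ln 2 - 2)"
  using sums_minus[OF Digamma_sums[of "3/2"]] Digamma_half_integer[of 1, where 'a = real] by simp

text \<open>Grouping the series with shift 3/2 in pairs of consecutive terms produces the shifts 3/4
  and 5/4 together with -1/(k+1/2) - 1/(k+1); adding the series with shift 1/2 removes the unwanted
  pole. The digamma values at 3/4 and 5/4 separately contain pi, which cancels in their sum.\<close>

lemma digamma_quarters_sums:
  "(\<lambda>k. 1 / (real k + 3/4) + 1 / (real k + 5/4) - 2 / (real k + 1)) sums (6 * ln 2 - 4)"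
proof -
  let ?f = "\<lambda>m. 2 / (real m + 3/2) - 2 / (real m + 1)"
  have "?f sums (2 * (2 * ln 2 - 2))"
    using sums_mult[OF digamma_three_halves_sums, of 2] by (simp add: right_diff_distrib)
  from sums_group[OF this, of 2]
  have "(\<lambda>k. ?f (2 * k) + ?f (2 * k + 1)) sums (2 * (2 * ln 2 - 2))"
    by (simp add: mult.commute numeral_2_eq_2 add_ac)
  from sums_add[OF this digamma_half_sums]
  have "(\<lambda>k. ?f (2 * k) + ?f (2 * k + 1) + (1 / (real k + 1/2) - 1 / (real k + 1))) sums (6 * ln 2 - 4)"
    by simp
  moreover have "?f (2 * k) + ?f (2 * k + 1) + (1 / (real k + 1/2) - 1 / (real k + 1))
      = 1 / (real k + 3/4) + 1 / (real k + 5/4) - 2 / (real k + 1)" for k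
  proof -
    have "2 / (2 * x + 3/2) - 2 / (2 * x + 1) + (2 / (2 * x + 1 + 3/2) - 2 / (2 * x + 1 + 1))
        + (1 / (x + 1/2) - 1 / (x + 1)) = 1 / (x + 3/4) + 1 / (x + 5/4) - 2 / (x + 1)"
      for x :: real
    proof -
      have half: "2 / (2 * y) = 1 / y" for y :: real by simp
      have "2 * x + 3/2 = 2 * (x + 3/4)" "2 * x + 1 + 3/2 = 2 * (x + 5/4)"
        "2 * x + 1 + 1 = 2 * (x + 1)" "2 * x + 1 = 2 * (x + 1/2)" by simp_all
      then have "2 / (2 * x + 3/2) = 1 / (x + 3/4)" "2 / (2 * x + 1 + 3/2) = 1 / (x + 5/4)"
        "2 / (2 * x + 1 + 1) = 1 / (x + 1)" "2 / (2 * x + 1) = 1 / (x + 1/2)"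
        by (simp_all only: half)
      then show ?thesis by simp
    qed
    from this[of "real k"] show ?thesis by (simp only: of_nat_add of_nat_mult of_nat_numeral of_nat_1)
  qed
  ultimately show ?thesis by simp
qed

lemma summable_cbinom_sq:
  assumes "\<And>k. 0 \<le> f k" "\<And>k. f k \<le> C * (cbinom (Suc k))\<^sup>2 / (real k + 1)"
  shows "summable f"
proof (rule summable_comparison_test'[where g = "\<lambda>k. \<bar>C\<bar> * inverse ((real (Suc k))\<^sup>2)" and N = 0])
  show "summable (\<lambda>k. \<bar>C\<bar> * inverse ((real (Suc k))\<^sup>2))"
    using inverse_power_summable[of 2, where 'a = real]
    by (intro summable_mult) (simp only: summable_Suc_iff[of "\<lambda>k. inverse ((real k)\<^sup>2)"])
  fix k
  have "f k \<le> \<bar>C\<bar> * (cbinom (Suc k))\<^sup>2 / (real k + 1)"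
    using assms(2)[of k] by (rule order_trans) (intro divide_right_mono mult_right_mono, auto)
  also have "\<dots> \<le> \<bar>C\<bar> * (1 / (2 * real (Suc k) + 1)) / (real k + 1)"
    by (intro divide_right_mono mult_left_mono cbinom_sq_le) auto
  also have "\<dots> \<le> \<bar>C\<bar> * (1 / real (Suc k)) / (real k + 1)"
    by (intro divide_right_mono mult_left_mono divide_left_mono) auto
  finally show "norm (f k) \<le> \<bar>C\<bar> * inverse ((real (Suc k))\<^sup>2)"
    using assms(1)[of k] by (simp add: power2_eq_square field_simps)
qed

lemma wz_weight_SucSuc:
  "wz_weight N (Suc (Suc k)) = wz_weight N (Suc k) * ((real k + 1 + 1/2) / (real N + 1 + (real k + 1)))\<^sup>2"
  "wz_weight (Suc N) (Suc k) = wz_weight N (Suc k) * ((real N + 1) / (real N + 1 + (real k + 1)))\<^sup>2"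
  using wz_weight_Suc_right[of N "Suc k"] wz_weight_Suc_left[of N "Suc k"] by (simp_all add: add_ac)

lemma wz_weight_1: "wz_weight N (Suc 0) = 1 / (4 * (real N + 1)\<^sup>2)"
  by (simp add: wz_weight_def power_divide power_mult_distrib[symmetric]) (simp add: power2_eq_square algebra_simps)

section \<open>Evaluation of the three series\<close>

lemma series_term_4_1_4_sums: "(\<lambda>n. series_term 4 1 4 (Suc n)) sums (2 * ln 2 - 1)"
proof -
  \<comment> \<open>The certificate variable is x = k + 1, since the coefficient 1/x excludes x = 0.
    At \<open>N = 0\<close> the coefficient is 1/x + 2/(2x+1), twice the one in (i).\<close>
  define F where "F N k = (1 / (real k + 1) + 1 / (real k + 1 + real N + 1/2)) * wz_weight N (Suc k)" for N k
  define G where "G N k = - (wz_weight N (Suc k) * (4 * real N + 2 + 2 * (real k + 1))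
     / ((2 * real N + 1) * (real k + 1 + real N + 1/2)))" for N k
  have bound: "F N k \<le> F 0 k / (real N + 1)\<^sup>2" for N k
  proof -
    have "F N k \<le> (1 / (real k + 1) + 1 / (real k + 1 + 1/2)) * (wz_weight 0 (Suc k) / (real N + 1)\<^sup>2)"
      unfolding F_def by (intro mult_mono add_left_mono wz_weight_le)
        (auto simp: wz_weight_nonneg intro!: divide_left_mono mult_pos_pos)
    then show ?thesis by (simp add: F_def)
  qed
  have nonneg: "F N k \<ge> 0" for N k
    by (auto simp: F_def wz_weight_nonneg intro!: mult_nonneg_nonneg add_nonneg_nonneg)
  have summ: "summable (F 0)"
  proof (rule summable_cbinom_sq[where C = 2, OF nonneg])
    fix k
    have "1 / (real k + 1 + real 0 + 1/2) \<le> 1 / (real k + 1)"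
      by (intro divide_left_mono) auto
    then have "1 / (real k + 1) + 1 / (real k + 1 + real 0 + 1/2) \<le> 2 / (real k + 1)"
      by simp
    from mult_right_mono[OF this wz_weight_nonneg, of 0 "Suc k"]
    show "F 0 k \<le> 2 * (cbinom (Suc k))\<^sup>2 / (real k + 1)"
      by (simp add: F_def wz_weight_0_left)
  qed
  have G0: "G N \<longlonglongrightarrow> 0" for N
  proof -
    have "(\<lambda>k. (4 * real N + 2 + 2 * (real k + 1)) / ((2 * real N + 1) * (real k + 1 + real N + 1/2)))
        \<longlonglongrightarrow> 2 * inverse (2 * real N + 1)"
      by real_asymp
    from tendsto_minus[OF tendsto_mult[OF LIMSEQ_Suc[OF wz_weight_tendsto_0[of N]] this]]
    show ?thesis by (simp add: G_def[abs_def])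
  qed
  have "(\<lambda>N. - G N 0) sums suminf (F 0)"
  proof (rule wz_sums_dominated[OF _ nonneg bound summ G0])
    fix N k
    show "F N k - F (Suc N) k = G N (Suc k) - G N k"
      unfolding F_def G_def wz_weight_SucSuc
      using wz_certificate1[of "real k + 1" "real N" "wz_weight N (Suc k)"]
      by (simp add: add_ac)
  qed
  \<comment> \<open>The numerator 4N + 4 cancels one factor of the (N+1)^2 in
    \<open>wz_weight_1\<close>. Only simple poles remain, so the sum needs digamma values
    alone.\<close>
  moreover have "- G N 0 = (1 / (real N + 1/2) - 1 / (real N + 1)) + (1 / (real N + 3/2) - 1 / (real N + 1))" for N
  proof -
    have "1 / (4 * (x + 1)\<^sup>2) * (4 * x + 2 + 2) / ((2 * x + 1) * (1 + x + 1/2))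
      = (1 / (x + 1/2) - 1 / (x + 1)) + (1 / (x + 3/2) - 1 / (x + 1))"
      if "x \<ge> 0" for x :: real
    proof -
      have "x + 1 \<noteq> 0" "x + 1/2 \<noteq> 0" "x + 3/2 \<noteq> 0" "2 * x + 1 \<noteq> 0" "1 + x + 1/2 \<noteq> 0" using that by linarith+
      then show ?thesis by (simp add: divide_simps) (simp add: algebra_simps power2_eq_square)
    qed
    from this[of "real N"] show ?thesis by (simp add: G_def wz_weight_1 add_ac)
  qed
  ultimately have "suminf (F 0) = 2 * ln 2 + (2 * ln 2 - 2)"
    using sums_add[OF digamma_half_sums digamma_three_halves_sums] sums_unique2 by simp
  with summable_sums[OF summ] have "F 0 sums (2 * ln 2 + (2 * ln 2 - 2))" by simp
  from sums_mult[OF this, of "1/2"] have "(\<lambda>k. 1/2 * F 0 k) sums (2 * ln 2 - 1)"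
    by (simp add: algebra_simps)
  moreover have "1/2 * F 0 k = series_term 4 1 4 (Suc k)" for k
  proof -
    have "1/2 * ((1 / x + 1 / (x + 1/2)) * y) = (4 * x + 1) / ((2 * x) * (2 * x + 1)) * y"
      if "x > 0" for x y :: real
    proof -
      have "x \<noteq> 0" "x + 1/2 \<noteq> 0" "2 * x + 1 \<noteq> 0" using that by linarith+
      then show ?thesis by (simp add: divide_simps)
    qed
    from this[of "real k + 1" "(cbinom (Suc k))\<^sup>2"] show ?thesis
      by (simp add: F_def wz_weight_0_left series_term_eq_cbinom add_ac)
  qed
  ultimately show ?thesis by simp
qed

lemma series_term_6_1_6_sums: "(\<lambda>n. series_term 6 1 6 (Suc n)) sums (3 * ln 2 - 2)"
proof -
  define F where "F N k = (2 * real N + 1/2 + 3 * (real k + 1)) / ((real k + 1) * (2 * real N + 1/2 + (real k + 1)))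
     * (wz_weight N (Suc k) / 4 ^ Suc k)" for N k
  define G where "G N k = - (wz_weight N (Suc k) / 4 ^ Suc k * (8 * real N + 4 + 4 * (real k + 1))
     / ((2 * real N + 1/2 + (real k + 1)) * (2 * real N + 3/2 + (real k + 1))))" for N k
  \<comment> \<open>The quotient on the left is what the certificate uses; its partial fractions
    show that the coefficient decreases in \<open>N\<close>, which gives
    \<open>bound\<close>.\<close>
  have coeff: "(2 * real N + 1/2 + 3 * (real k + 1)) / ((real k + 1) * (2 * real N + 1/2 + (real k + 1)))
    = 1 / (real k + 1) + 2 / (2 * real N + 1/2 + (real k + 1))" for N k
  proof -
    have "(y + 3 * x) / (x * (y + x)) = 1 / x + 2 / (y + x)"
      if "x > 0" "y > 0" for x y :: real
      using that by (simp add: divide_simps)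
    from this[of "real k + 1" "2 * real N + 1/2"] show ?thesis by simp
  qed
  have bound: "F N k \<le> F 0 k / (real N + 1)\<^sup>2" for N k
  proof -
    have "F N k \<le> (1 / (real k + 1) + 2 / (2 * real 0 + 1/2 + (real k + 1))) * (wz_weight 0 (Suc k) / (real N + 1)\<^sup>2 / 4 ^ Suc k)"
      unfolding F_def coeff
      by (intro mult_mono add_left_mono wz_weight_le divide_right_mono)
        (auto simp: wz_weight_nonneg intro!: divide_left_mono mult_pos_pos)
    then show ?thesis unfolding F_def coeff by (simp add: mult_ac)
  qed
  have nonneg: "F N k \<ge> 0" for N k
    by (auto simp: F_def wz_weight_nonneg intro!: mult_nonneg_nonneg add_nonneg_nonneg divide_nonneg_pos)
  have summ: "summable (F 0)"
  proof (rule summable_cbinom_sq[where C = 3, OF nonneg])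
    fix k
    have "2 / (2 * real 0 + 1/2 + (real k + 1)) \<le> 2 / (real k + 1)"
      by (intro divide_left_mono) auto
    then have "1 / (real k + 1) + 2 / (2 * real 0 + 1/2 + (real k + 1)) \<le> 3 / (real k + 1)"
      by simp
    then have "F 0 k \<le> 3 / (real k + 1) * (wz_weight 0 (Suc k) / 1)"
      unfolding F_def coeff using one_le_power[of "4::real" "Suc k"]
      by (intro mult_mono divide_left_mono) (auto simp: wz_weight_nonneg)
    then show "F 0 k \<le> 3 * (cbinom (Suc k))\<^sup>2 / (real k + 1)"
      by (simp add: wz_weight_0_left)
  qed
  have G0: "G N \<longlonglongrightarrow> 0" for N
  proof -
    have "(\<lambda>k. (8 * real N + 4 + 4 * (real k + 1)) / ((2 * real N + 1/2 + (real k + 1)) * (2 * real N + 3/2 + (real k + 1))) / 4 ^ Suc k) \<longlonglongrightarrow> 0"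
      by real_asymp
    from tendsto_minus[OF tendsto_mult[OF LIMSEQ_Suc[OF wz_weight_tendsto_0[of N]] this]]
    show ?thesis by (simp add: G_def[abs_def] mult_ac)
  qed
  have "(\<lambda>N. - G N 0) sums suminf (F 0)"
  proof (rule wz_sums_dominated[OF _ nonneg bound summ G0])
    fix N k
    show "F N k - F (Suc N) k = G N (Suc k) - G N k"
      unfolding F_def G_def wz_weight_SucSuc
      using wz_certificate2[of "real k + 1" "real N" "wz_weight N (Suc k) / 4 ^ Suc k"]
      by (simp add: add_ac)
  qed
  \<comment> \<open>Again one factor \<open>N + 1\<close> cancels, and the linear factors in 2N
    contribute simple poles at -3/4 and -5/4.\<close>
  moreover have "- G N 0 = 1 / (real N + 3/4) + 1 / (real N + 5/4) - 2 / (real N + 1)" for N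
  proof -
    have "1 / (4 * (x + 1)\<^sup>2) / 4 * (8 * x + 4 + 4) / ((2 * x + 1/2 + 1) * (2 * x + 3/2 + 1))
      = 1 / (x + 3/4) + 1 / (x + 5/4) - 2 / (x + 1)"
      if "x \<ge> 0" for x :: real
    proof -
      have "x + 1 \<noteq> 0" "x + 3/4 \<noteq> 0" "x + 5/4 \<noteq> 0" "2 * x + 1/2 + 1 \<noteq> 0" "2 * x + 3/2 + 1 \<noteq> 0" using that by linarith+
      then show ?thesis by (simp add: divide_simps) (simp add: algebra_simps power2_eq_square)
    qed
    from this[of "real N"] show ?thesis by (simp add: G_def wz_weight_1 add_ac)
  qed
  ultimately have "suminf (F 0) = 6 * ln 2 - 4"
    using digamma_quarters_sums sums_unique2 by simp
  with summable_sums[OF summ] have "F 0 sums (6 * ln 2 - 4)" by simp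
  from sums_mult[OF this, of "1/2"] have "(\<lambda>k. 1/2 * F 0 k) sums (3 * ln 2 - 2)"
    by (simp add: algebra_simps)
  moreover have "1/2 * F 0 k = series_term 6 1 6 (Suc k)" for k
  proof -
    have "1/2 * ((1/2 + 3 * x) / (x * (1/2 + x)) * y) = (6 * x + 1) / ((2 * x) * (2 * x + 1)) * y"
      if "x > 0" for x y :: real
    proof -
      have "x \<noteq> 0" "1/2 + x \<noteq> 0" "2 * x + 1 \<noteq> 0" using that by linarith+
      then show ?thesis by (simp add: divide_simps) (simp add: algebra_simps power2_eq_square)
    qed
    from this[of "real k + 1" "(cbinom (Suc k))\<^sup>2 / 4 ^ Suc k"] show ?thesis
      by (simp add: F_def wz_weight_0_left series_term_eq_cbinom add_ac power_divide)
  qed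
  ultimately show ?thesis by simp
qed


lemma series_term_15_2_8_sums: "(\<lambda>n. series_term 15 2 8 (Suc n)) sums (8 * ln 2 - 11/2)"
proof -
  \<comment> \<open>The certificate variable n is \<open>N + 1\<close>: the certificate divides by
    n, and the series (iii) starts at n = 1. Here \<open>x\<close> is \<open>real k\<close>, which
    may be 0.\<close>
  define w :: "nat \<Rightarrow> nat \<Rightarrow> real"
    where "w N k = pochhammer (1/2) (Suc N) ^ 4 * (fact k / fact (k + 2 * Suc N))\<^sup>2" for N k
  \<comment> \<open>The cubic numerator of the certificate. At x = 0 only its constant term is left;
    its square factor cancels against the denominator and leaves 15n + 2 over 2n(2n+1).\<close>
  define p :: "nat \<Rightarrow> real \<Rightarrow> real" where "p N x = ((15 * (real N + 1) + 2) * (real N + 1 + 1/2)\<^sup>2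
      + (17 * (real N + 1)\<^sup>2 + 25/2 * (real N + 1) + 2) * x + (7 * (real N + 1) + 5/2) * x\<^sup>2 + x^3) / (real N + 1)" for N x
  define F where "F N k = 4 * w N k / (real k + (real N + 1) + 1/2)" for N k
  define G where "G N k = - (w N k * p N (real k)
    / ((real k + 2 * (real N + 1) + 1)\<^sup>2 * (real k + (real N + 1) + 1/2)))" for N k
  have w_Suc_left: "w (Suc N) k = w N k * (real N + 1 + 1/2)^4
      * (1 / ((real k + 2 * (real N + 1) + 1) * (real k + 2 * (real N + 1) + 2)))\<^sup>2" for N k
  proof -
    have 1: "pochhammer (1/2) (Suc (Suc N)) = pochhammer (1/2) (Suc N) * (real N + 1 + 1/2)"
      using pochhammer_rec'[of "1/2::real" "Suc N"] by (simp add: add_ac mult_ac)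
    have 2: "fact k / fact (k + 2 * Suc (Suc N)) = (fact k / fact (k + 2 * Suc N) :: real)
      * (1 / ((real k + 2 * (real N + 1) + 1) * (real k + 2 * (real N + 1) + 2)))"
      by (simp add: add_ac mult_ac)
    show ?thesis unfolding w_def 1 2 power_mult_distrib by (simp only: mult_ac)
  qed
  have w_Suc_right: "w N (Suc k) = w N k * ((real k + 1) / (real k + 2 * (real N + 1) + 1))\<^sup>2" for N k
  proof -
    have 2: "fact (Suc k) / fact (Suc k + 2 * Suc N) = (fact k / fact (k + 2 * Suc N) :: real)
      * ((real k + 1) / (real k + 2 * (real N + 1) + 1))"
      by (simp add: add_ac mult_ac)
    show ?thesis unfolding w_def 2 power_mult_distrib by (simp only: mult_ac)
  qed
  have w_nonneg: "w N k \<ge> 0" for N k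
    by (auto simp: w_def intro!: mult_nonneg_nonneg)
  have nonneg: "F N k \<ge> 0" for N k
    using w_nonneg by (auto simp: F_def intro!: divide_nonneg_nonneg)
  \<comment> \<open>The actual ratio is at most ((n+1/2)/(2n+1))^4 = 1/16. The weaker 1/4 is enough
    for the domination by 1/(N+1)^2, because N + 2 \<le> 2(N+1).\<close>
  have w_step: "w (Suc N) k \<le> w N k / 4" for N k
  proof -
    let ?n = "real N + 1"
    have "(?n + 1/2)\<^sup>2 * (1 / ((real k + 2 * ?n + 1) * (real k + 2 * ?n + 2)))
        \<le> (?n + 1/2)\<^sup>2 * (1 / ((2 * ?n + 1) * (2 * ?n + 1)))"
      by (intro mult_left_mono divide_left_mono mult_mono mult_pos_pos) auto
    also have "\<dots> = 1/4"
    proof -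
      have "(x + 1/2)\<^sup>2 * (1 / ((2 * x + 1) * (2 * x + 1))) = 1/4"
        if "x \<ge> 0" for x :: real
      proof -
        have "2 * x + 1 \<noteq> 0" using that by linarith+
        then show ?thesis by (simp add: divide_simps) (simp add: algebra_simps power2_eq_square)
      qed
      from this[of ?n] show ?thesis by simp
    qed
    finally have "((?n + 1/2)\<^sup>2 * (1 / ((real k + 2 * ?n + 1) * (real k + 2 * ?n + 2))))\<^sup>2 \<le> (1/4)\<^sup>2"
      by (intro power_mono) auto
    moreover have "(x\<^sup>2 * y)\<^sup>2 = x^4 * y\<^sup>2" for x y :: real
      by (simp add: power_mult_distrib flip: power_mult)
    ultimately have "(?n + 1/2)^4 * (1 / ((real k + 2 * ?n + 1) * (real k + 2 * ?n + 2)))\<^sup>2 \<le> 1/16"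
      by (simp only: power_divide) simp
    then have "(?n + 1/2)^4 * (1 / ((real k + 2 * ?n + 1) * (real k + 2 * ?n + 2)))\<^sup>2 \<le> 1/4"
      by (rule order_trans) simp
    from mult_left_mono[OF this w_nonneg[of N k]] show ?thesis
      unfolding w_Suc_left by (simp add: mult_ac)
  qed
  have bound: "F N k \<le> F 0 k / (real N + 1)\<^sup>2" for N k
  proof (induction N)
    case (Suc N)
    have "F (Suc N) k \<le> 4 * (w N k / 4) / (real k + (real N + 1) + 1/2)"
      unfolding F_def using w_step w_nonneg by (intro frac_le mult_left_mono) auto
    also have "\<dots> = F N k / 4"
    proof -
      have "4 * (x / 4) / y = 4 * x / y / 4" for x y :: real by simp
      then show ?thesis by (simp only: F_def)
    qed
    also have "\<dots> \<le> F 0 k / (real N + 1)\<^sup>2 / 4" using Suc by simp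
    also have "\<dots> = F 0 k / (2 * (real N + 1))\<^sup>2" by (simp only: power_mult_distrib) simp
    also have "\<dots> \<le> F 0 k / (real (Suc N) + 1)\<^sup>2"
      using nonneg by (intro divide_left_mono power_mono) auto
    finally show ?case .
  qed simp
  have w_lim: "w N \<longlonglongrightarrow> 0" for N
  proof -
    have "(\<lambda>k. fact k / fact (k + 2 * Suc N) :: real) \<longlonglongrightarrow> 0"
    proof (rule tendsto_sandwich[of "\<lambda>_. 0"])
      show "\<forall>\<^sub>F k in sequentially. fact k / fact (k + 2 * Suc N) \<le> 1 / (real k + 1)"
      proof (intro always_eventually allI)
        fix k
        have "fact (Suc k) \<le> (fact (k + 2 * Suc N) :: real)" by (rule fact_mono) simp
        then have "fact k / fact (k + 2 * Suc N) \<le> (fact k / fact (Suc k) :: real)"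
          by (intro divide_left_mono) auto
        then show "fact k / fact (k + 2 * Suc N) \<le> 1 / (real k + 1)"
          by (simp add: add_ac)
      qed
      show "(\<lambda>k. 1 / (real k + 1)) \<longlonglongrightarrow> 0" by real_asymp
    qed auto
    from tendsto_mult[OF tendsto_const[of "pochhammer (1/2) (Suc N) ^ 4"] tendsto_power[OF this, of 2]]
    show ?thesis by (simp add: w_def[abs_def])
  qed
  have G0: "G N \<longlonglongrightarrow> 0" for N
  proof -
    have *: "(\<lambda>k. (a + b * real k + c * (real k)\<^sup>2 + real k ^ 3) / ((real k + 2 * n + 1)\<^sup>2 * (real k + n + 1/2))) \<longlonglongrightarrow> 1" for a b c n :: real
      by real_asymp
    from tendsto_divide[OF *[of "(15 * (real N + 1) + 2) * (real N + 1 + 1/2)\<^sup>2" "17 * (real N + 1)\<^sup>2 + 25/2 * (real N + 1) + 2" "7 * (real N + 1) + 5/2" "real N + 1"]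
      tendsto_const[of "real N + 1"]]
    have "(\<lambda>k. p N (real k) / ((real k + 2 * (real N + 1) + 1)\<^sup>2 * (real k + (real N + 1) + 1/2))) \<longlonglongrightarrow> 1 / (real N + 1)"
      unfolding p_def by (simp add: divide_divide_eq_left mult.commute)
    from tendsto_minus[OF tendsto_mult[OF w_lim[of N] this]]
    show ?thesis by (simp add: G_def[abs_def])
  qed
  have F0: "F 0 sums (8 * ln 2 - 11/2)"
  proof -
    have 1: "(\<lambda>k. 1 / (real k + 1)\<^sup>2 - 1 / (real k + 2)\<^sup>2) sums 1"
    proof -
      have "(\<lambda>k. 1 / (real k + 1)\<^sup>2) \<longlonglongrightarrow> 0" by real_asymp
      from telescope_sums'[OF this] show ?thesis by (simp add: add_ac)
    qed
    have 2: "(\<lambda>k. 1 / (real k + 1) - 1 / (real k + 2)) sums 1"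
    proof -
      have "(\<lambda>k. 1 / (real k + 1)) \<longlonglongrightarrow> 0" by real_asymp
      from telescope_sums'[OF this] show ?thesis by (simp add: add_ac)
    qed
    \<comment> \<open>Partial fractions arranged so that two of the three groups telescope. Only the
      middle one contributes a logarithm, and the values add up to 1/2 + (8 ln 2 - 8) + 2.\<close>
    have F0_eq: "F 0 k = 1/2 * (1 / (real k + 1)\<^sup>2 - 1 / (real k + 2)\<^sup>2)
      + 4 * (1 / (real k + 3/2) - 1 / (real k + 1)) + 2 * (1 / (real k + 1) - 1 / (real k + 2))" for k
    proof -
      have "F 0 k = 1/4 / (((real k + 1) * (real k + 2))\<^sup>2 * (real k + 3/2))"
      proof -
        have "fact (k + 2 * Suc 0) = ((real k + 1) * (real k + 2) * fact k :: real)"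
          by (simp add: mult_ac add_ac)
        then have "w 0 k = 1/16 * (1 / ((real k + 1) * (real k + 2)))\<^sup>2"
          by (simp add: w_def power_divide del: fact_Suc)
        then show ?thesis by (simp add: F_def power_divide)
      qed
      moreover have "1/4 / (((x + 1) * (x + 2))\<^sup>2 * (x + 3/2)) = 1/2 * (1 / (x + 1)\<^sup>2 - 1 / (x + 2)\<^sup>2)
        + 4 * (1 / (x + 3/2) - 1 / (x + 1)) + 2 * (1 / (x + 1) - 1 / (x + 2))"
        if "x \<ge> 0" for x :: real
      proof -
        have "x + 1 \<noteq> 0" "x + 2 \<noteq> 0" "x + 3/2 \<noteq> 0" using that by linarith+
        then show ?thesis by (simp add: divide_simps) (simp add: algebra_simps power2_eq_square)
      qed
      ultimately show ?thesis by simp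
    qed
    have "1/2 * 1 + 4 * (2 * ln 2 - 2) + 2 * 1 = 8 * ln 2 - (11/2 :: real)" by simp
    with sums_add[OF sums_add[OF sums_mult[OF 1, of "1/2"] sums_mult[OF digamma_three_halves_sums, of 4]] sums_mult[OF 2, of 2]]
    show ?thesis unfolding sums_cong[OF F0_eq] by simp
  qed
  have "(\<lambda>N. - G N 0) sums suminf (F 0)"
  proof (rule wz_sums_dominated[OF _ nonneg bound sums_summable[OF F0] G0])
    fix N k
    show "F N k - F (Suc N) k = G N (Suc k) - G N k"
      unfolding F_def G_def w_Suc_left w_Suc_right p_def
      using wz_certificate3[of "real k" "real N + 1" "w N k"]
      by (simp add: add_ac)
  qed
  moreover have "- G N 0 = series_term 15 2 8 (Suc N)" for N
  proof -
    have wN0: "w N 0 = (cbinom (Suc N))\<^sup>2 * (1/16) ^ Suc N"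
    proof -
      have "w N 0 = (pochhammer (1/2) (Suc N) ^ 2 / fact (2 * Suc N))\<^sup>2"
        unfolding w_def by (simp only: power_divide power_mult[symmetric]) simp
      also have "fact (2 * Suc N) = (4 ^ Suc N * pochhammer (1/2) (Suc N) * fact (Suc N) :: real)"
        using fact_double[of "Suc N", where 'a = real] by (simp add: power_mult del: fact_Suc)
      also have "pochhammer (1/2) (Suc N) ^ 2 / (4 ^ Suc N * pochhammer (1/2) (Suc N) * fact (Suc N))
         = cbinom (Suc N) * (1/4) ^ Suc N"
        using pochhammer_pos[of "1/2::real" "Suc N"]
        by (simp only: cbinom_def power2_eq_square power_divide) (simp del: fact_Suc)
      finally show ?thesis
        by (simp only: power_mult_distrib power_mult[symmetric] mult.commute[of _ 2])
           (simp only: power_mult, simp add: power2_eq_square)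
    qed
    have "y * ((15 * x + 2) * (x + 1/2)\<^sup>2 / x) / ((2 * x + 1)\<^sup>2 * (x + 1/2))
       = (15 * x + 2) / (2 * x * (2 * x + 1)) * y"
      if "x > 0" for x y :: real
    proof -
      have "x \<noteq> 0" "x + 1/2 \<noteq> 0" "2 * x + 1 \<noteq> 0" using that by linarith+
      then show ?thesis by (simp add: divide_simps) (simp add: algebra_simps power2_eq_square)
    qed
    from this[of "real N + 1" "w N 0"] have GN0: "- G N 0 = (15 * (real N + 1) + 2) / (2 * (real N + 1) * (2 * (real N + 1) + 1)) * w N 0"
      by (simp add: G_def p_def)
    show ?thesis
      unfolding GN0 wN0 series_term_eq_cbinom by (simp add: add_ac)
  qed
  ultimately show ?thesis using sums_unique[OF F0] by simp
qed

section \<open>Means of periodic functions and Jensen's formula\<close>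

text \<open>Shifting, stretching and the fundamental theorem of calculus are carried out with gauge
  integrals, while the Mahler measure is an iterated Lebesgue integral over \<open>lborel\<close>.
  Borel measurability and absolute integrability are carried along to pass from one to the
  other.\<close>

definition has_mean :: "(real \<Rightarrow> real) \<Rightarrow> real \<Rightarrow> bool" where
  "has_mean f c \<longleftrightarrow> f \<in> borel_measurable borel \<and> f absolutely_integrable_on {0..1}
     \<and> (f has_integral c) {0..1}"

lemma has_meanD:
  assumes "has_mean f c"
  shows "set_integrable lborel {0..1} f" "(LBINT t:{0..1}. f t) = c"
proof -
  have "f \<in> borel_measurable borel" "f absolutely_integrable_on {0..1}" "(f has_integral c) {0..1}"
    using assms by (auto simp: has_mean_def)
  then show *: "set_integrable lborel {0..1} f"
    unfolding set_integrable_def by (subst (asm) integrable_completion) auto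
  show "(LBINT t:{0..1}. f t) = c"
    using set_borel_integral_eq_integral(2)[OF *] \<open>(f has_integral c) {0..1}\<close> by (simp add: integral_unique)
qed

lemma has_mean_unique: "has_mean f c \<Longrightarrow> has_mean f d \<Longrightarrow> c = d"
  using has_meanD(2) by blast

text \<open>Absolute integrability is automatic here: \<open>M - f\<close> is nonnegative and
  integrable. This suits logarithms, whose singularities go to minus infinity only.\<close>

lemma has_mean_bounded_above:
  assumes "f \<in> borel_measurable borel" "(f has_integral c) {0..1}" "\<And>t. t \<in> {0..1} \<Longrightarrow> f t \<le> M"
  shows "has_mean f c"
  unfolding has_mean_def
proof (intro conjI assms(1,2))
  show "f absolutely_integrable_on {0..1}"
    by (rule absolutely_integrable_component_ubound[of _ _ "\<lambda>_. M"])
       (use assms in \<open>auto simp: has_integral_integrable\<close>)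
qed

lemma has_mean_add: "has_mean f c \<Longrightarrow> has_mean g d \<Longrightarrow> has_mean (\<lambda>t. f t + g t) (c + d)"
  by (auto simp: has_mean_def intro!: has_integral_add set_integral_add)

lemma has_mean_const: "has_mean (\<lambda>_. c) c"
  using has_integral_const_real[of c 0 1] by (auto simp: has_mean_def)

lemma has_mean_cmult: "has_mean f c \<Longrightarrow> has_mean (\<lambda>t. a * f t) (a * c)"
  by (auto simp: has_mean_def intro!: has_integral_mult_right)

lemma has_mean_spike:
  assumes "has_mean f c" "g \<in> borel_measurable borel" "negligible S"
    and "\<And>t. t \<notin> S \<Longrightarrow> g t = f t"
  shows "has_mean g c"
  using assms unfolding has_mean_def
  by (auto intro: has_integral_spike[OF assms(3)] absolutely_integrable_spike[OF _ assms(3)])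

lemma periodic_of_int:
  fixes f :: "real \<Rightarrow> 'a"
  assumes "\<And>t. f (t + 1) = f t"
  shows "f (t + of_int n) = f t"
proof (induction n rule: int_induct[of _ 0])
  case (step1 i)
  then show ?case using assms[of "t + of_int i"] by (simp add: add_ac)
next
  case (step2 i)
  then show ?case using assms[of "t + of_int i - 1"] by (simp add: algebra_simps)
qed simp

text \<open>Only the fractional part of the shift matters; cutting the period there and exchanging
  the two pieces preserves the integral.\<close>

lemma has_integral_periodic_shift:
  fixes f :: "real \<Rightarrow> real"
  assumes per: "\<And>t. f (t + 1) = f t" and f: "(f has_integral c) {0..1}"
  shows "((\<lambda>t. f (t + a)) has_integral c) {0..1}"
proof -
  define b where "b = frac a"
  have b: "0 \<le> b" "b < 1" by (auto simp: b_def frac_lt_1)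
  have eq: "f (t + a) = f (t + b)" for t
    using periodic_of_int[of f "t + b" "\<lfloor>a\<rfloor>"] per by (simp add: b_def frac_def)
  have int: "f integrable_on {0..b}" "f integrable_on {b..1}"
    using f b by (auto intro: integrable_subinterval_real[OF has_integral_integrable[OF f]])
  then obtain i j where i: "(f has_integral i) {0..b}" and j: "(f has_integral j) {b..1}"
    by (auto simp: integrable_on_def)
  have c: "c = i + j"
    using has_integral_combine[OF _ _ i j] b has_integral_unique[OF f] by auto
  have 1: "((\<lambda>t. f (t + b)) has_integral j) {0..1-b}"
    using has_integral_shift_real_ivl[OF j, of b] by simp
  have "((\<lambda>t. f (t + (b - 1))) has_integral i) {1-b..1}"
    using has_integral_shift_real_ivl[OF i, of "b - 1"] by simp
  moreover have "f (t + (b - 1)) = f (t + b)" for t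
    using per[of "t + (b - 1)"] by (simp add: algebra_simps)
  ultimately have "((\<lambda>t. f (t + b)) has_integral i) {1-b..1}" by simp
  from has_integral_combine[OF _ _ 1 this] b c eq show ?thesis by (simp add: add.commute)
qed

lemma has_mean_shift:
  assumes "has_mean f c" "\<And>t. f (t + 1) = f t"
  shows "has_mean (\<lambda>t. f (t + a)) c"
proof -
  from assms have f: "f \<in> borel_measurable borel" "(f has_integral c) {0..1}"
    "(\<lambda>t. \<bar>f t\<bar>) integrable_on {0..1}"
    by (auto simp: has_mean_def absolutely_integrable_on_def)
  from f(3) obtain d where d: "((\<lambda>t. \<bar>f t\<bar>) has_integral d) {0..1}" by (auto simp: integrable_on_def)
  show ?thesis unfolding has_mean_def absolutely_integrable_on_def
    using f(1) has_integral_periodic_shift[OF assms(2) f(2), of a]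
      has_integral_periodic_shift[OF _ d, of a] assms(2)
    by (auto simp: has_integral_integrable)
qed

lemma has_integral_periodic_double:
  fixes f :: "real \<Rightarrow> real"
  assumes per: "\<And>t. f (t + 1) = f t" and f: "(f has_integral c) {0..1}"
  shows "((\<lambda>t. f (2 * t)) has_integral c) {0..1}"
proof -
  have img: "(\<lambda>x. x / 2) ` {0..1::real} = {0..1/2}"
    by (auto simp: image_iff intro!: bexI[of _ "2 * _"])
  have 1: "((\<lambda>t. f (2 * t)) has_integral c / 2) {0..1/2}"
    using has_integral_stretch_real[OF f, of 2] unfolding img by simp
  have "((\<lambda>t. f (2 * (t - 1/2))) has_integral c / 2) {1/2..1}"
    using has_integral_shift_real_ivl[OF 1, of "-1/2"] by simp
  moreover have "f (2 * (t - 1/2)) = f (2 * t)" for t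
    using per[of "2 * t - 1"] by (simp add: algebra_simps)
  ultimately have "((\<lambda>t. f (2 * t)) has_integral c / 2) {1/2..1}" by simp
  from has_integral_combine[OF _ _ 1 this] show ?thesis by simp
qed

lemma has_mean_double:
  assumes "has_mean f c" "\<And>t. f (t + 1) = f t"
  shows "has_mean (\<lambda>t. f (2 * t)) c"
proof -
  from assms have f: "f \<in> borel_measurable borel" "(f has_integral c) {0..1}"
    "(\<lambda>t. \<bar>f t\<bar>) integrable_on {0..1}"
    by (auto simp: has_mean_def absolutely_integrable_on_def)
  from f(3) obtain d where d: "((\<lambda>t. \<bar>f t\<bar>) has_integral d) {0..1}" by (auto simp: integrable_on_def)
  show ?thesis unfolding has_mean_def absolutely_integrable_on_def
    using f(1) has_integral_periodic_double[OF assms(2) f(2)]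
      has_integral_periodic_double[OF _ d] assms(2)
    by (auto simp: has_integral_integrable)
qed

lemma negligible_countable: "countable S \<Longrightarrow> negligible (S :: real set)"
  using countable_imp_null_set_lborel[of S] by (simp add: negligible_iff_null_sets null_sets_completionI)

lemma negligible_sin_zeros: "a \<noteq> 0 \<Longrightarrow> negligible {t :: real. sin (a * t + b) = 0}"
proof (rule negligible_countable)
  assume a: "a \<noteq> 0"
  have "{t. sin (a * t + b) = 0} \<subseteq> range (\<lambda>n :: int. (of_int n * pi - b) / a)"
  proof
    fix t assume "t \<in> {t. sin (a * t + b) = 0}"
    then obtain n :: int where "a * t + b = of_int n * pi" by (auto simp: sin_zero_iff_int2)
    then have "t = (of_int n * pi - b) / a" using a by (simp add: field_simps)
    then show "t \<in> range (\<lambda>n :: int. (of_int n * pi - b) / a)" by blast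
  qed
  then show "countable {t. sin (a * t + b) = 0}" by (rule countable_subset) auto
qed

text \<open>The lower bound t(1-t) is chosen so that the logarithmic singularities at both ends are
  dominated by a Beta integrand. For s \<le> 1/2 put y = pi s / 2: the mean value theorem gives sin
  y \<ge> y cos y, and cos y ^ 2 \<ge> 1/2 then gives sin (2y) \<ge> y \<ge> s. The other half
  follows by symmetry.\<close>

lemma sin_pi_ge:
  assumes "0 \<le> t" "t \<le> (1::real)"
  shows "sin (pi * t) \<ge> t * (1 - t)"
proof -
  have *: "sin (pi * s) \<ge> s" if "0 \<le> s" "s \<le> 1/2" for s :: real
  proof (cases "s = 0")
    case False
    define y where "y = pi * s / 2"
    have y: "0 < y" "y \<le> pi / 4" using that False by (auto simp: y_def field_simps)
    have cos_y: "cos y \<ge> sqrt 2 / 2"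
      using cos_monotone_0_pi_le[of y "pi/4"] y cos_45 by simp
    then have cos_y0: "cos y \<ge> 0" by (rule order_trans[rotated]) simp
    obtain z where z: "0 < z" "z < y" "sin y - sin 0 = (y - 0) * cos z"
      using MVT2[OF y(1), of sin cos] by (auto intro: derivative_intros)
    have "cos y \<le> cos z" using cos_monotone_0_pi_le[of z y] z y by simp
    then have "sin y \<ge> y * cos y" using z y by (simp add: mult_left_mono)
    then have "2 * sin y * cos y \<ge> 2 * (y * cos y) * cos y"
      using cos_y0 by (intro mult_right_mono) auto
    moreover have "cos y * cos y \<ge> sqrt 2 / 2 * (sqrt 2 / 2)"
      using cos_y cos_y0 by (intro mult_mono) auto
    then have "2 * y * (cos y * cos y) \<ge> 2 * y * (1/2)"
      using y by (intro mult_left_mono) auto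
    ultimately have "sin (2 * y) \<ge> y" unfolding sin_double by (simp add: mult_ac)
    moreover have "y \<ge> s" using pi_gt3 that False by (simp add: y_def field_simps)
    moreover have "2 * y = pi * s" by (simp add: y_def)
    ultimately show ?thesis by simp
  qed simp
  show ?thesis
  proof (cases "t \<le> 1/2")
    case True
    have "t * (1 - t) \<le> t * 1" using assms by (intro mult_left_mono) auto
    with *[of t] True assms show ?thesis by simp
  next
    case False
    have "t * (1 - t) \<le> 1 * (1 - t)" using assms by (intro mult_right_mono) auto
    also have "\<dots> \<le> sin (pi * (1 - t))" using *[of "1 - t"] False assms by simp
    also have "\<dots> = sin (pi * t)" by (simp add: right_diff_distrib sin_diff)
    finally show ?thesis .
  qed
qed

section \<open>Means of ln |2 sin| and of ln |1 - q z|^2 on the unit circle\<close>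

definition ln_2sin :: "real \<Rightarrow> real" where "ln_2sin t = ln \<bar>2 * sin (pi * t)\<bar>"

lemma ln_2sin_periodic: "ln_2sin (t + 1) = ln_2sin t"
  by (simp add: ln_2sin_def distrib_left)

lemma ln_2sin_measurable [measurable]: "ln_2sin \<in> borel_measurable borel"
  unfolding ln_2sin_def[abs_def] by measurable

text \<open>
  Since \<open>ln_2sin t + ln_2sin (t + 1/2) = ln_2sin (2 * t)\<close> almost everywhere, the mean \<open>c\<close> satisfies
  \<open>c + c = c\<close>. For \<open>lnquad\<close> with \<open>\<bar>q\<bar> < 1\<close> the same argument gives \<open>2 * I q = I (q\<^sup>2)\<close>, and
  \<open>I\<close> is bounded near \<open>0\<close>.
\<close>

lemma has_mean_ln_2sin: "has_mean ln_2sin 0"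
proof -
  have "ln_2sin absolutely_integrable_on {0..1}"
  proof (rule measurable_bounded_by_integrable_imp_absolutely_integrable)
    \<comment> \<open>The majorant is the integrand of Beta(1/2, 1/2). It comes from ln x \<le> x -
      1 at x = u^(-1/2) with u = t(1-t), the lower bound for the sine.\<close>
    show "(\<lambda>t. ln 2 + 2 * (t powr (1/2 - 1) * (1 - t) powr (1/2 - 1)) :: real) integrable_on {0..1}"
      using set_borel_integral_eq_integral(1)[OF integrable_Beta[of "1/2" "1/2"]]
      by (intro integrable_add integrable_on_cmult_left) auto
    show "norm (ln_2sin t) \<le> ln 2 + 2 * (t powr (1/2 - 1) * (1 - t) powr (1/2 - 1))" if t: "t \<in> {0..1}" for t
    proof (cases "t = 0 \<or> t = 1")
      case False
      with t have t: "0 < t" "t < 1" by auto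
      define u where "u = t * (1 - t)"
      have u: "u > 0" "u \<le> sin (pi * t)" using t sin_pi_ge[of t] by (auto simp: u_def)
      have "- (1/2) * ln u = ln (u powr (-1/2))" using u by (simp add: ln_powr)
      also have "\<dots> \<le> u powr (-1/2)" using u by (intro order_trans[OF ln_le_minus_one]) auto
      finally have "- ln u \<le> 2 * u powr (-1/2)" by simp
      also have "u powr (-1/2) = t powr (1/2 - 1) * (1 - t) powr (1/2 - 1)"
        using t by (simp add: u_def powr_mult)
      finally have lower: "- ln u \<le> 2 * (t powr (1/2 - 1) * (1 - t) powr (1/2 - 1))" .
      have "ln_2sin t = ln 2 + ln (sin (pi * t))"
        using u by (simp add: ln_2sin_def ln_mult)
      moreover have "ln u \<le> ln (sin (pi * t))" using u by simp
      moreover have "ln (sin (pi * t)) \<le> 0" using u by simp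
      moreover have "ln (2::real) \<ge> 0" by simp
      ultimately show ?thesis using lower unfolding real_norm_def by linarith
    qed (auto simp: ln_2sin_def)
    show "ln_2sin \<in> borel_measurable (lebesgue_on {0..1})"
      by (intro measurable_restrict_space1 measurable_completion) simp
  qed auto
  then obtain c where c: "has_mean ln_2sin c"
    by (auto simp: has_mean_def absolutely_integrable_on_def integrable_on_def)
  have sum: "has_mean (\<lambda>t. ln_2sin t + ln_2sin (t + 1/2)) (c + c)"
    by (intro has_mean_add has_mean_shift c ln_2sin_periodic)
  \<comment> \<open>At the excluded points one of the sines is 0, and the convention
    \<open>ln 0 = 0\<close> breaks the additivity of the logarithm.\<close>
  have double: "ln_2sin t + ln_2sin (t + 1/2) = ln_2sin (2 * t)" if "t \<notin> {t. sin (2 * pi * t + 0) = 0}" for t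
  proof -
    have s: "sin (2 * (pi * t)) = 2 * sin (pi * t) * cos (pi * t)" by (rule sin_double)
    with that have nz: "sin (pi * t) \<noteq> 0" "cos (pi * t) \<noteq> 0" by (auto simp: mult.assoc)
    have "sin (pi * (t + 1/2)) = cos (pi * t)" by (simp add: distrib_left sin_add)
    moreover have "sin (pi * (2 * t)) = 2 * sin (pi * t) * cos (pi * t)"
      using s by (simp add: mult_ac)
    moreover have "ln 4 = 2 * ln (2::real)" using ln_realpow[of 2 2] by simp
    ultimately show ?thesis using nz
      by (simp only: ln_2sin_def abs_mult) (simp add: ln_mult)
  qed
  have "has_mean (\<lambda>t. ln_2sin t + ln_2sin (t + 1/2)) c"
  proof (rule has_mean_spike[OF has_mean_double[OF c ln_2sin_periodic]])
    show "negligible {t. sin (2 * pi * t + 0) = 0}" by (rule negligible_sin_zeros) simp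
  qed (use double in auto)
  from has_mean_unique[OF sum this] c show ?thesis by simp
qed

text \<open>\<open>lnquad q t\<close> is \<open>2 * ln \<bar>1 - q * exp (2 * pi * \<i> * t)\<bar>\<close>.\<close>

definition lnquad :: "real \<Rightarrow> real \<Rightarrow> real" where
  "lnquad q t = ln (1 + q\<^sup>2 - 2 * q * cos (2 * pi * t))"

lemma lnquad_periodic: "lnquad q (t + 1) = lnquad q t"
  by (simp add: lnquad_def distrib_left)

lemma lnquad_arg_bounds:
  fixes q x :: real
  assumes "\<bar>q\<bar> < 1"
  shows "(1 - \<bar>q\<bar>)\<^sup>2 \<le> 1 + q\<^sup>2 - 2 * q * cos x" "1 + q\<^sup>2 - 2 * q * cos x \<le> (1 + \<bar>q\<bar>)\<^sup>2"
proof -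
  have "\<bar>q * cos x\<bar> \<le> \<bar>q\<bar>" using mult_left_le[of "\<bar>cos x\<bar>" "\<bar>q\<bar>"] by (simp add: abs_mult)
  then have "q * cos x \<le> \<bar>q\<bar>" "- \<bar>q\<bar> \<le> q * cos x" by (simp_all add: abs_le_iff)
  then show "(1 - \<bar>q\<bar>)\<^sup>2 \<le> 1 + q\<^sup>2 - 2 * q * cos x" "1 + q\<^sup>2 - 2 * q * cos x \<le> (1 + \<bar>q\<bar>)\<^sup>2"
    by (simp_all add: power2_eq_square algebra_simps)
qed

text \<open>One constant bounds the logarithm on both sides because (1 + r)(1 - r) \<le> 1. Its
  uniformity over all parameters up to \<open>r\<close> is what keeps the means bounded under
  repeated squaring of \<open>q\<close>.\<close>

lemma abs_lnquad_le:
  assumes "\<bar>q\<bar> \<le> r" "r < 1"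
  shows "\<bar>lnquad q t\<bar> \<le> - 2 * ln (1 - r)"
proof -
  let ?u = "1 + q\<^sup>2 - 2 * q * cos (2 * pi * t)"
  have q: "\<bar>q\<bar> < 1" using assms by simp
  have pos: "(1 - r)\<^sup>2 > 0" using assms by simp
  have "(1 - r)\<^sup>2 \<le> (1 - \<bar>q\<bar>)\<^sup>2" using assms by (intro power_mono) auto
  also note lnquad_arg_bounds(1)[OF q, of "2 * pi * t"]
  finally have lower: "(1 - r)\<^sup>2 \<le> ?u" .
  note lnquad_arg_bounds(2)[OF q, of "2 * pi * t"]
  also have "(1 + \<bar>q\<bar>)\<^sup>2 \<le> (1 + r)\<^sup>2" using assms by (intro power_mono) auto
  also have "\<dots> \<le> 1 / (1 - r)\<^sup>2"
  proof -
    have "((1 + r) * (1 - r))\<^sup>2 \<le> 1"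
    proof (rule power_le_one)
      show "(1 + r) * (1 - r) \<le> 1" by (simp add: algebra_simps)
    qed (use assms in auto)
    then show ?thesis using pos by (simp add: pos_le_divide_eq power_mult_distrib)
  qed
  finally have upper: "?u \<le> 1 / (1 - r)\<^sup>2" .
  have u: "?u > 0" using lower pos by linarith
  have "ln ((1 - r)\<^sup>2) \<le> ln ?u" using lower pos u by simp
  moreover have "ln ?u \<le> ln (1 / (1 - r)\<^sup>2)" using upper pos u by simp
  moreover have "ln ((1 - r)\<^sup>2) = 2 * ln (1 - r)" using assms ln_realpow[of "1 - r" 2] by simp
  moreover have "ln (1 / (1 - r)\<^sup>2) = - ln ((1 - r)\<^sup>2)" using pos by (simp add: ln_div)
  ultimately show ?thesis unfolding lnquad_def abs_le_iff by linarith
qed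

lemma has_mean_lnquad_ex:
  assumes "\<bar>q\<bar> < 1"
  shows "\<exists>c. has_mean (lnquad q) c"
proof -
  have "continuous_on {0..1} (lnquad q)"
    unfolding lnquad_def[abs_def]
  proof (intro continuous_intros)
    show "\<forall>x\<in>{0..1}. 1 + q\<^sup>2 - 2 * q * cos (2 * pi * x) \<noteq> 0"
    proof
      fix x
      have "0 < (1 - \<bar>q\<bar>)\<^sup>2" using assms by simp
      with lnquad_arg_bounds(1)[OF assms, of "2 * pi * x"] show "1 + q\<^sup>2 - 2 * q * cos (2 * pi * x) \<noteq> 0" by linarith
    qed
  qed
  then have "lnquad q integrable_on {0..1}" by (rule integrable_continuous_real)
  then obtain c where c: "(lnquad q has_integral c) {0..1}" by (auto simp: integrable_on_def)
  have "has_mean (lnquad q) c"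
  proof (rule has_mean_bounded_above[OF _ c])
    show "lnquad q \<in> borel_measurable borel" unfolding lnquad_def[abs_def] by measurable
    show "lnquad q t \<le> - 2 * ln (1 - \<bar>q\<bar>)" for t
      using abs_lnquad_le[of q "\<bar>q\<bar>" t] assms by simp
  qed
  then show ?thesis ..
qed

text \<open>This is (1 - z)(1 + z) = 1 - z^2 for z = q exp(2 pi i t), after taking absolute values
  and logarithms.\<close>

lemma lnquad_double:
  assumes "\<bar>q\<bar> < 1"
  shows "lnquad q t + lnquad q (t + 1/2) = lnquad (q\<^sup>2) (2 * t)"
proof -
  define c where "c = cos (2 * pi * t)"
  have 1: "cos (2 * pi * (t + 1/2)) = - c" by (simp add: c_def distrib_left)
  have "cos (2 * pi * (2 * t)) = cos (2 * (2 * pi * t))" by (simp add: mult_ac)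
  then have 2: "cos (2 * pi * (2 * t)) = 2 * c\<^sup>2 - 1" by (simp only: cos_double_cos c_def)
  have p: "0 < (1 - \<bar>q\<bar>)\<^sup>2" using assms by simp
  have pos: "1 + q\<^sup>2 - 2 * q * c > 0" "1 + q\<^sup>2 - 2 * q * (- c) > 0"
    using lnquad_arg_bounds(1)[OF assms, of "2 * pi * t"] lnquad_arg_bounds(1)[OF assms, of "2 * pi * (t + 1/2)"] p
    unfolding 1 c_def[symmetric] by linarith+
  have "lnquad q t + lnquad q (t + 1/2) = ln ((1 + q\<^sup>2 - 2 * q * c) * (1 + q\<^sup>2 - 2 * q * (- c)))"
    unfolding lnquad_def 1 c_def[symmetric] by (rule ln_mult_pos[OF pos, symmetric])
  also have "(1 + q\<^sup>2 - 2 * q * c) * (1 + q\<^sup>2 - 2 * q * (- c)) = 1 + (q\<^sup>2)\<^sup>2 - 2 * q\<^sup>2 * (2 * c\<^sup>2 - 1)"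
    by (simp add: power2_eq_square algebra_simps)
  finally show ?thesis unfolding lnquad_def 2 .
qed

lemma has_mean_lnquad_less:
  assumes "\<bar>q\<bar> < 1"
  shows "has_mean (lnquad q) 0"
proof -
  define I where "I p = (SOME c. has_mean (lnquad p) c)" for p
  have I: "has_mean (lnquad p) (I p)" if "\<bar>p\<bar> < 1" for p
    unfolding I_def using someI_ex[OF has_mean_lnquad_ex[OF that]] .
  have step: "2 * I p = I (p\<^sup>2)" if p: "\<bar>p\<bar> < 1" for p
  proof -
    have p2: "\<bar>p\<^sup>2\<bar> < 1" using p by (simp add: abs_square_less_1)
    have "has_mean (\<lambda>t. lnquad p t + lnquad p (t + 1/2)) (I p + I p)"
      by (intro has_mean_add has_mean_shift I p lnquad_periodic)
    moreover have "has_mean (\<lambda>t. lnquad (p\<^sup>2) (2 * t)) (I (p\<^sup>2))"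
      by (intro has_mean_double I p2 lnquad_periodic)
    ultimately show ?thesis
      using has_mean_unique unfolding lnquad_double[OF p] by fastforce
  qed
  have bound: "\<bar>I p\<bar> \<le> - 2 * ln (1 - \<bar>q\<bar>)" if "\<bar>p\<bar> \<le> \<bar>q\<bar>" for p
  proof -
    have h: "(lnquad p has_integral I p) {0..1}" using I[of p] that assms by (simp add: has_mean_def)
    have const: "((\<lambda>_. K) has_integral K) {0..1 :: real}" for K :: real
      using has_integral_const_real[of K 0 1] by simp
    have le: "\<bar>lnquad p t\<bar> \<le> - 2 * ln (1 - \<bar>q\<bar>)" for t
      using abs_lnquad_le[OF that] assms by simp
    have "I p \<le> - 2 * ln (1 - \<bar>q\<bar>)"
      using le by (intro has_integral_le[OF h const]) (simp add: abs_le_iff)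
    moreover have "2 * ln (1 - \<bar>q\<bar>) \<le> I p"
    proof (rule has_integral_le[OF const h])
      show "2 * ln (1 - \<bar>q\<bar>) \<le> lnquad p t" for t using le[of t] unfolding abs_le_iff by linarith
    qed
    ultimately show ?thesis by (simp add: abs_le_iff)
  qed
  have iter: "2 ^ n * I p = I (p ^ (2 ^ n))" if "\<bar>p\<bar> < 1" for n p
  proof (induction n)
    case (Suc n)
    have "\<bar>p ^ 2 ^ n\<bar> < 1" using that by (simp add: power_abs power_less_one_iff)
    from step[OF this] have "2 * I (p ^ 2 ^ n) = I (p ^ 2 ^ Suc n)"
      by (simp add: power_mult[symmetric] mult.commute)
    with Suc show ?case by simp
  qed simp
  have "\<bar>q ^ 2 ^ n\<bar> \<le> \<bar>q\<bar>" for n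
    using power_decreasing[of 1 "2 ^ n" "\<bar>q\<bar>"] assms by (simp add: power_abs)
  then have *: "\<bar>2 ^ n * I q\<bar> \<le> - 2 * ln (1 - \<bar>q\<bar>)" for n
    unfolding iter[OF assms] by (rule bound)
  have "I q = 0"
  proof (rule ccontr)
    assume "I q \<noteq> 0"
    then have pos: "\<bar>I q\<bar> > 0" by simp
    obtain n where "(- 2 * ln (1 - \<bar>q\<bar>)) / \<bar>I q\<bar> < 2 ^ n"
      using real_arch_pow[of 2] by auto
    then have "- 2 * ln (1 - \<bar>q\<bar>) < 2 ^ n * \<bar>I q\<bar>"
      unfolding pos_divide_less_eq[OF pos] .
    with *[of n] show False by (simp add: abs_mult)
  qed
  with I[OF assms] show ?thesis by simp
qed

text \<open>On the boundary, |1 - exp(2 pi i t)| = |2 sin(pi t)| reduces q = 1 to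
  \<open>ln_2sin\<close>, and q = -1 is a half-period shift of it.\<close>

lemma has_mean_lnquad:
  assumes "\<bar>q\<bar> \<le> 1"
  shows "has_mean (lnquad q) 0"
proof (cases "\<bar>q\<bar> < 1")
  case False
  have sq: "2 - 2 * cos (2 * pi * t) = \<bar>2 * sin (pi * t)\<bar>\<^sup>2" for t
    using cos_double_sin[of "pi * t"] by (simp add: power_mult_distrib mult.assoc)
  have 1: "lnquad 1 t = 2 * ln_2sin t" for t
  proof -
    have "1 + 1\<^sup>2 - 2 * 1 * cos (2 * pi * t) = 2 - 2 * cos (2 * pi * t)" by simp
    then have "lnquad 1 t = ln (\<bar>2 * sin (pi * t)\<bar>\<^sup>2)" unfolding lnquad_def sq by simp
    then show ?thesis using ln_realpow[of "\<bar>2 * sin (pi * t)\<bar>" 2]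
      by (cases "sin (pi * t) = 0") (auto simp: ln_2sin_def)
  qed
  have "has_mean (\<lambda>t. 2 * ln_2sin t) (2 * 0)" by (intro has_mean_cmult has_mean_ln_2sin)
  then have h: "has_mean (lnquad 1) 0" unfolding 1[symmetric] by simp
  have "lnquad (-1) t = lnquad 1 (t + 1/2)" for t
    by (simp add: lnquad_def distrib_left)
  then have "has_mean (lnquad (-1)) 0" using has_mean_shift[OF h lnquad_periodic, of "1/2"] by presburger
  with h False assms show ?thesis by (cases "q = 1") (auto simp: abs_if split: if_splits)
qed (rule has_mean_lnquad_less)

section \<open>Jensen's formula for a + b cos\<close>

text \<open>For nonzero \<open>b\<close> this is Jensen's formula for (b z^2 + 2 a z + b)/2. Its
  zeros are real and reciprocal when |b| \<le> |a|, and the one of larger modulus joins the leading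
  coefficient; when |a| < |b| both lie on the unit circle and only the leading coefficient
  counts.\<close>

definition jensen_mean :: "real \<Rightarrow> real \<Rightarrow> real" where
  "jensen_mean a b = (if \<bar>b\<bar> \<le> \<bar>a\<bar> then ln ((\<bar>a\<bar> + sqrt (a\<^sup>2 - b\<^sup>2)) / 2) else ln (\<bar>b\<bar> / 2))"

lemma has_mean_jensen_ge:
  assumes "\<bar>b\<bar> \<le> a"
  shows "has_mean (\<lambda>t. ln \<bar>a + b * cos (2 * pi * t)\<bar>) (ln ((a + sqrt (a\<^sup>2 - b\<^sup>2)) / 2))"
proof (cases "a = 0")
  case True
  \<comment> \<open>Here \<open>b\<close> is 0 as well, and both the integrand and the claimed mean
    are the default value \<open>ln 0 = 0\<close>.\<close>
  with assms show ?thesis using has_mean_const[of 0] by simp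
next
  case False
  with assms have a: "a > 0" by simp
  define r where "r = sqrt (a\<^sup>2 - b\<^sup>2)"
  have r2: "r\<^sup>2 = a\<^sup>2 - b\<^sup>2" "r \<ge> 0"
    using assms abs_le_square_iff[of b a] by (auto simp: r_def)
  define C where "C = (a + r) / 2"
  \<comment> \<open>For nonzero \<open>b\<close> this is the zero of b z^2 + 2 a z + b of modulus at
    most 1, so a + b cos x = C |1 - q exp(i x)|^2.\<close>
  define q where "q = - b / (a + r)"
  have C: "C > 0" using a r2 by (simp add: C_def)
  have ar: "a + r > 0" using a r2 by simp
  have q: "\<bar>q\<bar> \<le> 1" using a r2 assms by (simp add: q_def divide_le_eq)
  have *: "C * (1 + q\<^sup>2 - 2 * q * x) = a + b * x" for x
  proof -
    have "2 * C * q = - b" using ar by (simp add: C_def q_def)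
    moreover have "C * (1 + q\<^sup>2) = a"
    proof -
      have "s > 0 \<Longrightarrow> s / 2 * (1 + (- b / s)\<^sup>2) * (2 * s) = s\<^sup>2 + b\<^sup>2" for s
        by (simp add: power2_eq_square field_simps)
      from this[OF ar] have "C * (1 + q\<^sup>2) * (2 * (a + r)) = (a + r)\<^sup>2 + b\<^sup>2"
        unfolding C_def q_def .
      also have "\<dots> = a * (2 * (a + r))"
        using r2(1) by (simp add: power2_eq_square algebra_simps)
      finally show ?thesis using ar by simp
    qed
    moreover have "C * (1 + q\<^sup>2 - 2 * q * x) = C * (1 + q\<^sup>2) - 2 * C * q * x" by (simp add: algebra_simps)
    ultimately show ?thesis by simp
  qed
  have "has_mean (\<lambda>t. ln C + lnquad q t) (ln C + 0)"
    by (intro has_mean_add has_mean_const has_mean_lnquad q)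
  then have "has_mean (\<lambda>t. ln \<bar>a + b * cos (2 * pi * t)\<bar>) (ln C + 0)"
  proof (rule has_mean_spike)
    show "negligible {t. sin (2 * pi * t + 0) = 0}" by (rule negligible_sin_zeros) simp
    fix t assume "t \<notin> {t. sin (2 * pi * t + 0) = 0}"
    then have s: "sin (2 * pi * t) \<noteq> 0" by simp
    have "(sin (2 * pi * t))\<^sup>2 > 0" using s by simp
    then have "(cos (2 * pi * t))\<^sup>2 < 1" using sin_cos_squared_add[of "2 * pi * t"] by linarith
    then have c1: "\<bar>cos (2 * pi * t)\<bar> < 1" by (simp add: abs_square_less_1)
    have "\<bar>b * cos (2 * pi * t)\<bar> < a"
    proof (cases "b = 0")
      case False
      have "\<bar>b\<bar> * \<bar>cos (2 * pi * t)\<bar> < \<bar>b\<bar> * 1" using c1 False by (intro mult_strict_left_mono) auto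
      with assms show ?thesis by (simp add: abs_mult)
    qed (use a in simp)
    then have pos: "a + b * cos (2 * pi * t) > 0" by (simp add: abs_less_iff)
    with *[of "cos (2 * pi * t)"] C have "1 + q\<^sup>2 - 2 * q * cos (2 * pi * t) > 0"
      by (simp add: zero_less_mult_iff flip: *)
    from ln_mult_pos[OF C this] show "ln \<bar>a + b * cos (2 * pi * t)\<bar> = ln C + lnquad q t"
      using pos by (simp add: * lnquad_def)
  qed measurable
  then show ?thesis by (simp add: C_def r_def)
qed

text \<open>With cos \<phi> = -a/b the function is b (cos x - cos \<phi>), a product of two sines.
  Its logarithm is a constant plus two translates of \<open>ln_2sin\<close>, each of mean 0.\<close>

lemma has_mean_jensen_less:
  assumes "\<bar>a\<bar> < \<bar>b\<bar>"
  shows "has_mean (\<lambda>t. ln \<bar>a + b * cos (2 * pi * t)\<bar>) (ln (\<bar>b\<bar> / 2))"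
proof -
  have b: "b \<noteq> 0" using assms by auto
  define \<phi> where "\<phi> = arccos (- a / b)"
  have "\<bar>- a / b\<bar> \<le> 1" using assms b by (simp add: divide_le_eq)
  then have cos_\<phi>: "cos \<phi> = - a / b" unfolding \<phi>_def by (intro cos_arccos_abs)
  define u where "u = \<phi> / (2 * pi)"
  have "has_mean (\<lambda>t. ln (\<bar>b\<bar> / 2) + (ln_2sin (t + u) + ln_2sin (t + (- u)))) (ln (\<bar>b\<bar> / 2) + (0 + 0))"
    by (intro has_mean_add has_mean_const has_mean_shift has_mean_ln_2sin ln_2sin_periodic)
  then have "has_mean (\<lambda>t. ln \<bar>a + b * cos (2 * pi * t)\<bar>) (ln (\<bar>b\<bar> / 2) + (0 + 0))"
  proof (rule has_mean_spike)
    show "negligible ({t. sin (pi * t + \<phi> / 2) = 0} \<union> {t. sin (pi * t + (- \<phi> / 2)) = 0})"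
      by (intro negligible_Un negligible_sin_zeros) simp_all
    fix t assume t: "t \<notin> {t. sin (pi * t + \<phi> / 2) = 0} \<union> {t. sin (pi * t + (- \<phi> / 2)) = 0}"
    have eq: "pi * (t + u) = pi * t + \<phi> / 2" "pi * (t + (- u)) = pi * t + (- \<phi> / 2)"
      by (simp_all add: u_def field_simps)
    have "a + b * cos (2 * pi * t) = b * (cos (2 * pi * t) - cos \<phi>)"
      using b by (simp add: cos_\<phi> field_simps)
    also have "cos (2 * pi * t) - cos \<phi> = - 2 * sin (pi * t + \<phi> / 2) * sin (pi * t + (- \<phi> / 2))"
      using cos_diff_cos[of "2 * pi * t" \<phi>] sin_minus[of "pi * t - \<phi> / 2"]
      by (simp add: add_divide_distrib diff_divide_distrib)
    finally have "\<bar>a + b * cos (2 * pi * t)\<bar>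
        = \<bar>b\<bar> / 2 * (\<bar>2 * sin (pi * t + \<phi> / 2)\<bar> * \<bar>2 * sin (pi * t + (- \<phi> / 2))\<bar>)"
      by (simp add: abs_mult)
    then show "ln \<bar>a + b * cos (2 * pi * t)\<bar> = ln (\<bar>b\<bar> / 2) + (ln_2sin (t + u) + ln_2sin (t + (- u)))"
      unfolding ln_2sin_def eq using t b by (simp only: ln_mult) (simp add: ln_mult)
  qed measurable
  then show ?thesis by simp
qed

lemma has_mean_jensen_mean: "has_mean (\<lambda>t. ln \<bar>a + b * cos (2 * pi * t)\<bar>) (jensen_mean a b)"
proof (cases "\<bar>b\<bar> \<le> \<bar>a\<bar>")
  case True
  show ?thesis
  proof (cases "a \<ge> 0")
    case True
    then show ?thesis using has_mean_jensen_ge[of b a] \<open>\<bar>b\<bar> \<le> \<bar>a\<bar>\<close> by (simp add: jensen_mean_def)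
  next
    case False
    have "\<bar>a + b * x\<bar> = \<bar>- a + (- b) * x\<bar>" for x by (simp add: abs_if)
    then show ?thesis using has_mean_jensen_ge[of "- b" "- a"] \<open>\<bar>b\<bar> \<le> \<bar>a\<bar>\<close> False by (simp add: jensen_mean_def)
  qed
next
  case False
  then show ?thesis using has_mean_jensen_less[of a b] by (simp add: jensen_mean_def)
qed

section \<open>Reduction of the Mahler measure to a single integral\<close>

lemma mahler_m_cos:
  "mahler_m \<alpha> = (LBINT t:{0..1}. LBINT s:{0..1}. ln \<bar>\<alpha> + 2 * cos (2 * pi * t) + 2 * cos (2 * pi * s)\<bar>)"
proof -
  have e: "exp (2 * pi * \<i> * complex_of_real s) + 1 / exp (2 * pi * \<i> * complex_of_real s)
      = complex_of_real (2 * cos (2 * pi * s))" for s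
  proof -
    have "exp (2 * pi * \<i> * complex_of_real s) = cis (2 * pi * s)"
      by (simp add: cis_conv_exp mult_ac)
    then show ?thesis by (simp add: complex_eq_iff cis_divide[of 0, simplified] cis.code inverse_eq_divide[symmetric])
  qed
  have "cmod (\<alpha> + exp (2 * pi * \<i> * of_real s) + 1 / exp (2 * pi * \<i> * of_real s)
       + exp (2 * pi * \<i> * of_real t) + 1 / exp (2 * pi * \<i> * of_real t))
     = \<bar>\<alpha> + 2 * cos (2 * pi * t) + 2 * cos (2 * pi * s)\<bar>" for s t
  proof -
    have "\<alpha> + exp (2 * pi * \<i> * of_real s) + 1 / exp (2 * pi * \<i> * of_real s)
       + exp (2 * pi * \<i> * of_real t) + 1 / exp (2 * pi * \<i> * of_real t)
      = complex_of_real \<alpha> + (exp (2 * pi * \<i> * of_real t) + 1 / exp (2 * pi * \<i> * of_real t))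
        + (exp (2 * pi * \<i> * of_real s) + 1 / exp (2 * pi * \<i> * of_real s))"
      by (simp only: add_ac)
    also have "\<dots> = complex_of_real (\<alpha> + 2 * cos (2 * pi * t) + 2 * cos (2 * pi * s))"
      unfolding e by simp
    finally show ?thesis by (simp only: norm_of_real)
  qed
  then show ?thesis unfolding mahler_m_eq by (simp only:)
qed

text \<open>A lower bound independent of \<open>b\<close>: together with the upper bound of the
  integrand it controls the integral of the absolute value, as Fubini's theorem requires.\<close>

lemma jensen_mean_ge:
  assumes "a > 0"
  shows "jensen_mean a b \<ge> ln (a / 2)"
proof (cases "\<bar>b\<bar> \<le> \<bar>a\<bar>")
  case True
  then have "b\<^sup>2 \<le> a\<^sup>2" using abs_le_square_iff[of b a] by simp
  then have "a / 2 \<le> (a + sqrt (a\<^sup>2 - b\<^sup>2)) / 2" by (intro divide_right_mono) auto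
  then have "ln (a / 2) \<le> ln ((a + sqrt (a\<^sup>2 - b\<^sup>2)) / 2)" using assms by (intro ln_mono) auto
  then show ?thesis using True assms by (simp add: jensen_mean_def)
next
  case False
  then show ?thesis using assms by (simp add: jensen_mean_def)
qed

text \<open>Replacing s by s + t turns the sum of two cosines into a product in which cos(pi s) does
  not involve t. Jensen's formula is then applied to the integral over t, which is the outer one, so
  the order has to be exchanged despite the singularities.\<close>

lemma mahler_m_jensen:
  assumes "\<alpha> \<ge> 1"
  shows "mahler_m \<alpha> = (LBINT s:{0..1}. jensen_mean \<alpha> (4 * cos (pi * s)))"
proof -
  define H where "H s t = ln \<bar>\<alpha> + 4 * cos (pi * s) * cos (2 * pi * t + pi * s)\<bar>" for s t
  have mean_t: "has_mean (H s) (jensen_mean \<alpha> (4 * cos (pi * s)))" for s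
  proof -
    have "has_mean (\<lambda>t. ln \<bar>\<alpha> + (4 * cos (pi * s)) * cos (2 * pi * (t + s / 2))\<bar>) (jensen_mean \<alpha> (4 * cos (pi * s)))"
      by (rule has_mean_shift[OF has_mean_jensen_mean]) (simp add: distrib_left)
    moreover have "2 * pi * (t + s / 2) = 2 * pi * t + pi * s" for t by (simp add: algebra_simps)
    ultimately show ?thesis by (simp add: H_def[abs_def])
  qed
  \<comment> \<open>For fixed t the substitution is a shift of a periodic function in s, so
    \<open>H\<close> has the same inner mean as the original integrand.\<close>
  have mean_s: "has_mean (\<lambda>s. H s t) (jensen_mean (\<alpha> + 2 * cos (2 * pi * t)) 2)" for t
  proof -
    have "has_mean (\<lambda>s. ln \<bar>(\<alpha> + 2 * cos (2 * pi * t)) + 2 * cos (2 * pi * (s + t))\<bar>) (jensen_mean (\<alpha> + 2 * cos (2 * pi * t)) 2)"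
      by (rule has_mean_shift[OF has_mean_jensen_mean]) (simp add: distrib_left)
    moreover have "(\<alpha> + 2 * cos (2 * pi * t)) + 2 * cos (2 * pi * (s + t))
        = \<alpha> + 4 * cos (pi * s) * cos (2 * pi * t + pi * s)" for s
    proof -
      have "cos (2 * pi * (s + t)) + cos (2 * pi * t)
          = 2 * cos ((2 * pi * (s + t) + 2 * pi * t) / 2) * cos ((2 * pi * (s + t) - 2 * pi * t) / 2)"
        by (rule cos_plus_cos)
      also have "(2 * pi * (s + t) + 2 * pi * t) / 2 = 2 * pi * t + pi * s" by (simp add: field_simps)
      also have "(2 * pi * (s + t) - 2 * pi * t) / 2 = pi * s" by (simp add: field_simps)
      finally show ?thesis by (simp add: mult_ac)
    qed
    ultimately show ?thesis by (simp add: H_def)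
  qed
  define c where "c = ln (\<alpha> + 4)"
  have c0: "c \<ge> 0" using assms by (simp add: c_def)
  have H_le: "H s t \<le> c" for s t
  proof (cases "\<alpha> + 4 * cos (pi * s) * cos (2 * pi * t + pi * s) = 0")
    case False
    have "\<bar>cos (pi * s) * cos (2 * pi * t + pi * s)\<bar> \<le> 1"
      by (simp add: abs_mult mult_le_one)
    then have "\<bar>\<alpha> + 4 * cos (pi * s) * cos (2 * pi * t + pi * s)\<bar> \<le> \<alpha> + 4"
      using assms unfolding mult.assoc by linarith
    with False show ?thesis by (simp add: H_def c_def)
  next
    case True
    then show ?thesis using c0 by (simp add: H_def)
  qed
  have H_meas [measurable]: "(\<lambda>p. H (fst p) (snd p)) \<in> borel_measurable (lborel \<Otimes>\<^sub>M lborel)"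
    unfolding H_def by measurable
  define h where "h s t = indicator {0..1} s *\<^sub>R (indicator {0..1} t *\<^sub>R H s t)" for s t :: real
  have h_meas: "(\<lambda>(s, t). h s t) \<in> borel_measurable (lborel \<Otimes>\<^sub>M lborel)"
    unfolding h_def case_prod_beta by measurable
  have set_t: "set_integrable lborel {0..1} (H s)" "(LBINT t:{0..1}. H s t) = jensen_mean \<alpha> (4 * cos (pi * s))" for s
    using has_meanD[OF mean_t] by auto
  have int_t: "integrable lborel (h s)" for s
    using set_t(1)[of s] unfolding h_def[abs_def] set_integrable_def by simp
  \<comment> \<open>From H \<le> c and c \<ge> 0 it follows that |H| \<le> 2c - H, and the integral
    of the right side is known from Jensen's formula.\<close>
  have norm_bound: "(\<integral>t. norm (h s t) \<partial>lborel) \<le> indicator {0..1} s * (2 * c - ln (\<alpha> / 2))" for s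
  proof (cases "s \<in> {0..1}")
    case True
    have "(\<integral>t. norm (h s t) \<partial>lborel) \<le> (LBINT t:{0..1}. 2 * c - H s t)"
      unfolding set_lebesgue_integral_def
    proof (rule integral_mono)
      show "integrable lborel (\<lambda>t. norm (h s t))" using int_t by (rule integrable_norm)
      show "integrable lborel (\<lambda>t. indicator {0..1} t *\<^sub>R (2 * c - H s t))"
        using set_integral_diff(1)[OF _ set_t(1), of "\<lambda>_. 2 * c"]
        by (simp add: set_integrable_def)
      show "norm (h s t) \<le> indicator {0..1} t *\<^sub>R (2 * c - H s t)" for t
        using True H_le[of s t] c0 by (auto simp: h_def indicator_def abs_le_iff)
    qed
    also have "\<dots> = 2 * c - jensen_mean \<alpha> (4 * cos (pi * s))"
      using set_integral_diff(2)[OF _ set_t(1), of "\<lambda>_. 2 * c" s] set_t(2)[of s]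
      by (simp add: set_integrable_def set_lebesgue_integral_def)
    also have "\<dots> \<le> 2 * c - ln (\<alpha> / 2)" using jensen_mean_ge[of \<alpha>] assms by simp
    finally show ?thesis using True by simp
  qed (simp add: h_def)
  have "integrable (lborel \<Otimes>\<^sub>M lborel) (\<lambda>(s, t). h s t)"
  proof (rule lborel_pair.Fubini_integrable[OF h_meas])
    show "integrable lborel (\<lambda>s. \<integral>t. norm (case (s, t) of (s, t) \<Rightarrow> h s t) \<partial>lborel)"
    proof (rule Bochner_Integration.integrable_bound)
      show "integrable lborel (\<lambda>s :: real. indicator {0..1} s * (2 * c - ln (\<alpha> / 2)) :: real)"
        by (intro integrable_mult_left integrable_real_indicator) auto
      show "(\<lambda>s. \<integral>t. norm (case (s, t) of (s, t) \<Rightarrow> h s t) \<partial>lborel) \<in> borel_measurable lborel"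
        using h_meas by measurable
      show "AE s in lborel. norm (\<integral>t. norm (case (s, t) of (s, t) \<Rightarrow> h s t) \<partial>lborel)
          \<le> norm (indicator {0..1} s * (2 * c - ln (\<alpha> / 2)) :: real)"
        using norm_bound by (intro AE_I2) (auto intro: order_trans[OF _ abs_ge_self])
    qed
    show "AE s in lborel. integrable lborel (\<lambda>t. case (s, t) of (s, t) \<Rightarrow> h s t)"
      using int_t by simp
  qed
  from lborel_pair.Fubini_integral[OF this]
  have swap: "(\<integral>t. (\<integral>s. h s t \<partial>lborel) \<partial>lborel) = (\<integral>s. (\<integral>t. h s t \<partial>lborel) \<partial>lborel)" .
  have "mahler_m \<alpha> = (LBINT t:{0..1}. LBINT s:{0..1}. H s t)"
    unfolding mahler_m_cos has_meanD(2)[OF mean_s] has_meanD(2)[OF has_mean_jensen_mean] ..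
  also have "\<dots> = (\<integral>t. (\<integral>s. h s t \<partial>lborel) \<partial>lborel)"
    unfolding set_lebesgue_integral_def h_def
    by (simp add: mult.left_commute)
  also have "\<dots> = (LBINT s:{0..1}. LBINT t:{0..1}. H s t)"
    unfolding swap unfolding set_lebesgue_integral_def h_def by simp
  finally show ?thesis unfolding set_t(2) .
qed

section \<open>Expansion of the Mahler measure\<close>

lemma summable_bounded_coeffs:
  fixes c :: "nat \<Rightarrow> real"
  assumes "\<And>n. \<bar>c n\<bar> \<le> 1" "\<bar>x\<bar> < 1"
  shows "summable (\<lambda>n. c n * x ^ n)"
proof (rule summable_comparison_test'[where g = "\<lambda>n. \<bar>x\<bar> ^ n" and N = 0])
  show "norm (c n * x ^ n) \<le> \<bar>x\<bar> ^ n" for n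
    using mult_right_mono[OF assms(1), of "\<bar>x\<bar> ^ n" n] by (simp add: abs_mult power_abs)
qed (use assms(2) in simp)

lemma cbinom_sums:
  assumes "\<bar>x\<bar> < 1"
  shows "(\<lambda>n. cbinom n * x ^ n) sums (1 / sqrt (1 - x))"
proof -
  have "(\<lambda>n. ((- 1/2) gchoose n) * (- x) ^ n) sums (1 + (- x)) powr (- 1/2)"
    using gen_binomial_real[of "- x" "- 1/2"] assms by simp
  moreover have "((- 1/2) gchoose n) * (- x) ^ n = cbinom n * x ^ n" for n
  proof -
    have "u * p / f * (u * X) = (u * u) * (p / f * X)" for u p f X :: real by simp
    moreover have "(- 1) ^ n * (- 1) ^ n = (1 :: real)" by (simp flip: power_mult_distrib)
    ultimately show ?thesis
      unfolding gbinomial_pochhammer power_minus[of x] cbinom_def by simp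
  qed
  moreover have "(1 + (- x)) powr (- 1/2) = 1 / sqrt (1 - x)"
    using assms by (simp add: powr_minus_divide powr_half_sqrt)
  ultimately show ?thesis by simp
qed

lemma abs_cbinom_div_le_1: "c \<ge> 1 \<Longrightarrow> \<bar>cbinom n / c\<bar> \<le> 1"
  using cbinom_pos[of n] cbinom_le_1[of n] by (simp add: abs_mult divide_le_eq)

text \<open>Both sides vanish at 0 and have the same derivative: with r = sqrt (1 - y), the
  differentiated series is (1/r - 1)/(2y) = 1/(2r(1+r)).\<close>

lemma cbinom_ln_series:
  assumes "\<bar>x\<bar> < 1"
  shows "(\<lambda>n. cbinom (Suc n) / (2 * (real n + 1)) * x ^ Suc n) sums (- ln ((1 + sqrt (1 - x)) / 2))"
proof -
  define f where "f n = cbinom (Suc n) / (2 * (real n + 1))" for n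
  define g where "g x = - ln ((1 + sqrt (1 - x)) / 2)" for x
  define h where "h x = suminf (\<lambda>n. f n * x ^ Suc n)" for x
  have f_le: "\<bar>f n\<bar> \<le> 1" for n
    unfolding f_def by (rule abs_cbinom_div_le_1) simp
  have eq: "f n * real (Suc n) * y ^ n = cbinom (Suc n) / 2 * y ^ n" for n y
    by (simp add: f_def field_simps)
  have D: "(\<lambda>n. cbinom (Suc n) / 2 * y ^ n) sums (1 / (2 * sqrt (1 - y) * (1 + sqrt (1 - y))))"
    if y: "\<bar>y\<bar> < 1" for y
  proof (cases "y = 0")
    case True
    then show ?thesis using powser_sums_zero[of "\<lambda>n. cbinom (Suc n) / 2"] by (simp add: cbinom_Suc)
  next
    case False
    define r where "r = sqrt (1 - y)"
    have r: "r > 0" "r\<^sup>2 = 1 - y" using y by (auto simp: r_def)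
    have r1: "r \<noteq> 1" using r False by auto
    have "(\<lambda>n. cbinom (Suc n) * y ^ Suc n) sums (1 / r - 1)"
      using cbinom_sums[OF y] unfolding r_def by (subst sums_Suc_iff) simp
    from sums_mult[OF this, of "1 / (2 * y)"]
    have "(\<lambda>n. cbinom (Suc n) / 2 * y ^ n) sums (1 / (2 * y) * (1 / r - 1))"
      using False by (simp add: field_simps)
    moreover have "1 / (2 * y) * (1 / r - 1) = 1 / (2 * r * (1 + r))"
    proof -
      have y_eq: "y = (1 - r) * (1 + r)" using r(2) by (simp add: algebra_simps power2_eq_square)
      show ?thesis unfolding y_eq using r(1) r1 by (simp add: divide_simps)
    qed
    ultimately show ?thesis by (simp add: r_def)
  qed
  have h_deriv: "(h has_field_derivative 1 / (2 * sqrt (1 - y) * (1 + sqrt (1 - y)))) (at y)" if y: "\<bar>y\<bar> < 1" for y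
  proof -
    have "(h has_field_derivative suminf (\<lambda>n. f n * real (Suc n) * y ^ n)) (at y)"
      unfolding h_def[abs_def]
    proof (rule DERIV_power_series'[where R = 1])
      show "summable (\<lambda>n. f n * real (Suc n) * z ^ n)" if "z \<in> {-1<..<1}" for z
        unfolding eq using D[of z] that by (auto simp: sums_iff)
    qed (use y in auto)
    then show ?thesis unfolding eq using D[OF y] by (simp add: sums_iff)
  qed
  have g_deriv: "(g has_field_derivative 1 / (2 * sqrt (1 - y) * (1 + sqrt (1 - y)))) (at y)" if y: "\<bar>y\<bar> < 1" for y
  proof -
    have p: "sqrt (1 - y) > 0" using y by simp
    have q: "1 + sqrt (1 - y) > 0" using p by linarith
    have "((\<lambda>y. sqrt (1 - y)) has_field_derivative inverse (sqrt (1 - y)) / 2 * (- 1)) (at y)"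
      using y by (intro DERIV_chain2[OF DERIV_real_sqrt]) (auto intro!: derivative_eq_intros)
    then have "((\<lambda>y. 1 + sqrt (1 - y)) has_field_derivative 0 + inverse (sqrt (1 - y)) / 2 * (- 1)) (at y)"
      by (intro DERIV_add DERIV_const)
    from DERIV_cdivide[OF this, of 2]
    have "((\<lambda>y. (1 + sqrt (1 - y)) / 2) has_field_derivative (inverse (sqrt (1 - y)) / 2 * (- 1)) / 2) (at y)"
      by (simp only: add_0)
    then have "(g has_field_derivative - (1 / ((1 + sqrt (1 - y)) / 2) * ((inverse (sqrt (1 - y)) / 2 * (- 1)) / 2))) (at y)"
      unfolding g_def[abs_def] using q by (intro DERIV_minus DERIV_chain2[OF DERIV_ln_divide]) auto
    moreover have "r > 0 \<Longrightarrow> - (1 / ((1 + r) / 2) * ((inverse r / 2 * (- 1)) / 2)) = 1 / (2 * r * (1 + r))" for r :: real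
      by (simp add: divide_simps)
    ultimately show ?thesis using p by simp
  qed
  have "\<exists>c. \<forall>y\<in>{-1<..<1}. h y - g y = c"
  proof (rule has_field_derivative_zero_constant)
    show "((\<lambda>y. h y - g y) has_field_derivative 0) (at y within {-1<..<1})" if "y \<in> {-1<..<1}" for y
      using DERIV_diff[OF h_deriv g_deriv, of y] that
      by (auto intro: has_field_derivative_at_within)
  qed auto
  then obtain c where c: "\<And>y. y \<in> {-1<..<1} \<Longrightarrow> h y - g y = c" by blast
  have "h 0 = 0" "g 0 = 0" by (simp_all add: h_def g_def)
  with c[of 0] c[of x] assms have "h x = g x" by (auto simp: abs_less_iff)
  moreover have "summable (\<lambda>n. f n * x ^ n * x)"
    by (intro summable_mult2 summable_bounded_coeffs f_le assms)
  then have "summable (\<lambda>n. f n * x ^ Suc n)" by (simp add: mult_ac)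
  ultimately show ?thesis by (simp add: sums_iff h_def g_def f_def)
qed

text \<open>The coefficients satisfy (2n+1) c n = \<open>cbinom n\<close>, so h solves 2 x h' + h =
  1 / sqrt (1 - x). At x = z^2 this says that z h(z^2) has the derivative of arcsin.\<close>

lemma arcsin_series:
  assumes "\<bar>y\<bar> < 1"
  shows "(\<lambda>n. cbinom n / (2 * real n + 1) * (y\<^sup>2) ^ n * y) sums arcsin y"
proof -
  define c where "c n = cbinom n / (2 * real n + 1)" for n
  define h where "h x = suminf (\<lambda>n. c n * x ^ n)" for x
  have c_le: "\<bar>c n\<bar> \<le> 1" for n
    unfolding c_def by (rule abs_cbinom_div_le_1) simp
  have sq: "\<bar>z\<^sup>2\<bar> < 1" if "\<bar>z\<bar> < 1" for z :: real using that by (simp add: abs_square_less_1)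
  have deriv: "((\<lambda>z. z * h (z\<^sup>2) - arcsin z) has_field_derivative 0) (at z)" if z: "\<bar>z\<bar> < 1" for z
  proof -
    have x: "\<bar>z\<^sup>2\<bar> < 1" using sq[OF z] .
    define h' where "h' = suminf (\<lambda>n. diffs c n * (z\<^sup>2) ^ n)"
    have hd: "(h has_field_derivative h') (at (z\<^sup>2))"
      unfolding h_def[abs_def] h'_def
      by (rule termdiffs_strong'[where K = 1]) (use summable_bounded_coeffs[OF c_le] x in auto)
    have "summable (\<lambda>n. diffs c n * (z\<^sup>2) ^ n)"
      by (rule termdiff_converges[where K = 1]) (use summable_bounded_coeffs[OF c_le] x in auto)
    from diffs_equiv[OF this] have "(\<lambda>n. real n * c n * (z\<^sup>2) ^ (n - Suc 0)) sums h'"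
      by (simp add: h'_def)
    from sums_mult2[OF this, of "z\<^sup>2"] have "(\<lambda>n. real n * c n * (z\<^sup>2) ^ n) sums (h' * z\<^sup>2)"
    proof (rule sums_cong[THEN iffD1, rotated])
      show "real n * c n * (z\<^sup>2) ^ (n - Suc 0) * z\<^sup>2 = real n * c n * (z\<^sup>2) ^ n" for n
        by (cases n) auto
    qed
    moreover have "(\<lambda>n. c n * (z\<^sup>2) ^ n) sums h (z\<^sup>2)"
      unfolding h_def by (intro summable_sums summable_bounded_coeffs c_le x)
    ultimately have "(\<lambda>n. 2 * (real n * c n * (z\<^sup>2) ^ n) + c n * (z\<^sup>2) ^ n) sums (2 * (h' * z\<^sup>2) + h (z\<^sup>2))"
      by (intro sums_add sums_mult)
    moreover have "2 * (real n * c n * (z\<^sup>2) ^ n) + c n * (z\<^sup>2) ^ n = cbinom n * (z\<^sup>2) ^ n" for n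
    proof -
      have "2 * (real n * c n * X) + c n * X = ((2 * real n + 1) * c n) * X" for X
        by (simp add: algebra_simps)
      moreover have "(2 * real n + 1) * c n = cbinom n" by (simp add: c_def)
      ultimately show ?thesis by simp
    qed
    ultimately have "(\<lambda>n. cbinom n * (z\<^sup>2) ^ n) sums (2 * (h' * z\<^sup>2) + h (z\<^sup>2))" by (simp only:)
    from sums_unique2[OF this cbinom_sums[OF x]]
    have eq: "2 * (h' * z\<^sup>2) + h (z\<^sup>2) = 1 / sqrt (1 - z\<^sup>2)" .
    have "((\<lambda>z. h (z\<^sup>2)) has_field_derivative h' * (2 * z)) (at z)"
      using hd by (rule DERIV_chain2[where f = h and g = "\<lambda>z. z\<^sup>2"]) (auto intro!: derivative_eq_intros)
    moreover have "(arcsin has_field_derivative 1 / sqrt (1 - z\<^sup>2)) (at z)"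
      using DERIV_arcsin[of z] z by (simp add: inverse_eq_divide abs_less_iff)
    ultimately have "((\<lambda>z. z * h (z\<^sup>2) - arcsin z) has_field_derivative
        (1 * h (z\<^sup>2) + h' * (2 * z) * z) - 1 / sqrt (1 - z\<^sup>2)) (at z)"
      by (intro DERIV_diff DERIV_mult' DERIV_ident) (auto simp: add.commute intro!: derivative_eq_intros)
    moreover have "(1 * h (z\<^sup>2) + h' * (2 * z) * z) - 1 / sqrt (1 - z\<^sup>2) = 0"
      using eq by (simp add: power2_eq_square mult_ac)
    ultimately show ?thesis by simp
  qed
  have "\<exists>C. \<forall>z\<in>{-1<..<1}. z * h (z\<^sup>2) - arcsin z = C"
  proof (rule has_field_derivative_zero_constant)
    show "((\<lambda>z. z * h (z\<^sup>2) - arcsin z) has_field_derivative 0) (at z within {-1<..<1})" if "z \<in> {-1<..<1}" for z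
      using deriv[of z] that by (auto intro: has_field_derivative_at_within)
  qed auto
  then obtain C where C: "\<And>z. z \<in> {-1<..<1} \<Longrightarrow> z * h (z\<^sup>2) - arcsin z = C" by blast
  from C[of 0] C[of y] assms have "arcsin y = h (y\<^sup>2) * y" by (auto simp: abs_less_iff mult.commute)
  moreover have "(\<lambda>n. c n * (y\<^sup>2) ^ n * y) sums (h (y\<^sup>2) * y)"
    unfolding h_def by (intro sums_mult2 summable_sums summable_bounded_coeffs c_le sq assms)
  ultimately show ?thesis by (simp add: c_def)
qed

section \<open>Moments of the squared sine and termwise integration\<close>

text \<open>Wallis' reduction: the antiderivative is a multiple of sin^(2n+1) cos, and the condition
  on \<open>b\<close> makes its boundary terms vanish for every n. It covers both a full and a half
  period.\<close>

lemma has_integral_sin_power: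
  assumes "b \<ge> 0" "sin (pi * b) * cos (pi * b) = 0"
  shows "((\<lambda>s. (sin (pi * s))\<^sup>2 ^ n) has_integral cbinom n * b) {0..b}"
proof (induction n)
  case 0
  show ?case using has_integral_const_real[of "1::real" 0 b] assms by simp
next
  case (Suc n)
  let ?S = "\<lambda>s. sin (pi * s)" and ?C = "\<lambda>s. cos (pi * s)"
  define F where "F s = ?S s ^ (2 * n + 1) * ?C s / (pi * (2 * real n + 2))" for s
  define F' where "F' s = (2 * real n + 1) / (2 * real n + 2) * (?S s)\<^sup>2 ^ n - (?S s)\<^sup>2 ^ Suc n" for s
  have "(F' has_integral F b - F 0) {0..b}"
  proof (rule fundamental_theorem_of_calculus[OF assms(1)])
    fix s
    have p: "pi * (2 * real n + 2) \<noteq> 0" by (simp add: add_nonneg_eq_0_iff)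
    have "(F has_field_derivative ((real (2 * n + 1) * ?S s ^ (2 * n) * (?C s * pi)) * ?C s
        + ?S s ^ (2 * n + 1) * (- ?S s * pi)) / (pi * (2 * real n + 2))) (at s)"
    proof -
      have "((\<lambda>s. ?S s ^ (2 * n + 1)) has_field_derivative real (2 * n + 1) * ?S s ^ (2 * n) * (?C s * pi)) (at s)"
      proof -
        have "(?S has_field_derivative ?C s * pi) (at s)" by (auto intro!: derivative_eq_intros)
        from DERIV_power[OF this, of "2 * n + 1"] show ?thesis by (simp add: mult_ac)
      qed
      moreover have "(?C has_field_derivative - ?S s * pi) (at s)" by (auto intro!: derivative_eq_intros)
      ultimately show ?thesis unfolding F_def[abs_def]
        by (intro DERIV_cdivide) (auto dest: DERIV_mult simp: algebra_simps)
    qed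
    also have "((real (2 * n + 1) * ?S s ^ (2 * n) * (?C s * pi)) * ?C s
        + ?S s ^ (2 * n + 1) * (- ?S s * pi)) / (pi * (2 * real n + 2)) = F' s"
    proof -
      have "real (2 * n + 1) * X * (C * pi) * C + X * S * (- S * pi)
          = pi * (2 * real n + 2) * ((2 * real n + 1) / (2 * real n + 2) * X - S\<^sup>2 * X)"
        if "C\<^sup>2 = 1 - S\<^sup>2" for X S C :: real
      proof -
        have nz: "2 * real n + 2 \<noteq> 0" by linarith
        have "real (2 * n + 1) * X * (C * pi) * C + X * S * (- S * pi)
          = pi * X * ((2 * real n + 1) * C\<^sup>2 - S\<^sup>2)" by (simp add: algebra_simps power2_eq_square)
        also have "\<dots> = pi * X * ((2 * real n + 1) - (2 * real n + 2) * S\<^sup>2)"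
          unfolding that by (simp add: algebra_simps)
        also have "\<dots> = pi * (2 * real n + 2) * ((2 * real n + 1) / (2 * real n + 2) * X - S\<^sup>2 * X)"
          using nz by (simp add: field_simps)
        finally show ?thesis .
      qed
      from this[of "?C s" "?S s" "(?S s)\<^sup>2 ^ n"]
      have "real (2 * n + 1) * ?S s ^ (2 * n) * (?C s * pi) * ?C s + ?S s ^ (2 * n + 1) * (- ?S s * pi)
          = pi * (2 * real n + 2) * F' s"
        by (simp only: cos_squared_eq power_mult power_add power_one_right F'_def power_Suc)
      with p show ?thesis by simp
    qed
    finally show "(F has_vector_derivative F' s) (at s within {0..b})"
      by (simp add: has_real_derivative_iff_has_vector_derivative has_vector_derivative_at_within)
  qed
  moreover have "F b - F 0 = 0"
    using assms(2) by (auto simp: F_def)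
  ultimately have "(F' has_integral 0) {0..b}" by simp
  from has_integral_diff[OF has_integral_mult_right[OF Suc, of "(2 * real n + 1) / (2 * real n + 2)"] this]
  show ?case by (simp add: F'_def cbinom_Suc mult_ac)
qed

text \<open>The geometric majorant r^n gives uniform convergence. Continuity of the limit is
  returned as well, because the small case differentiates an integral of such a series.\<close>

lemma has_integral_power_series:
  fixes c m :: "nat \<Rightarrow> real" and u :: "real \<Rightarrow> real"
  assumes c: "\<And>n. \<bar>c n\<bar> \<le> 1" and r: "0 \<le> r" "r < 1"
    and u: "continuous_on {a..b} u" "\<And>s. s \<in> {a..b} \<Longrightarrow> 0 \<le> u s \<and> u s \<le> 1"
    and m: "\<And>n. ((\<lambda>s. u s ^ n) has_integral m n) {a..b}"
  obtains J where "((\<lambda>s. suminf (\<lambda>n. c n * (r * u s) ^ n)) has_integral J) {a..b}"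
    "(\<lambda>n. c n * r ^ n * m n) sums J"
    "continuous_on {a..b} (\<lambda>s. suminf (\<lambda>n. c n * (r * u s) ^ n))"
proof -
  let ?f = "\<lambda>N s. \<Sum>n<N. c n * (r * u s) ^ n"
  have lim: "uniform_limit {a..b} ?f (\<lambda>s. suminf (\<lambda>n. c n * (r * u s) ^ n)) sequentially"
  proof (rule Weierstrass_m_test)
    show "summable (\<lambda>n. r ^ n)" using r by simp
    show "norm (c n * (r * u s) ^ n) \<le> r ^ n" if "s \<in> {a..b}" for n s
    proof -
      have "(r * u s) ^ n \<le> r ^ n" using r u(2)[OF that] by (intro power_mono) (auto simp: mult_left_le)
      moreover have "(r * u s) ^ n \<ge> 0" using r u(2)[OF that] by simp
      ultimately show ?thesis using mult_mono[of "\<bar>c n\<bar>" 1 "(r * u s) ^ n" "r ^ n"] c[of n] by (simp add: abs_mult)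
    qed
  qed
  have cont: "continuous_on {a..b} (?f N)" for N
    using u(1) by (intro continuous_intros)
  from uniform_limit_integral[OF lim cont] obtain I J
    where I: "\<And>N. (?f N has_integral I N) {a..b}"
      and J: "((\<lambda>s. suminf (\<lambda>n. c n * (r * u s) ^ n)) has_integral J) {a..b}" and IJ: "I \<longlonglongrightarrow> J"
    by auto
  have "(?f N has_integral (\<Sum>n<N. c n * r ^ n * m n)) {a..b}" for N
  proof (rule has_integral_sum)
    show "((\<lambda>s. c n * (r * u s) ^ n) has_integral c n * r ^ n * m n) {a..b}" for n
      using has_integral_mult_right[OF m[of n], of "c n * r ^ n"] by (simp add: power_mult_distrib mult_ac)
  qed simp
  then have "I = (\<lambda>N. \<Sum>n<N. c n * r ^ n * m n)" using has_integral_unique[OF I] by blast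
  with IJ have "(\<lambda>n. c n * r ^ n * m n) sums J" by (simp add: sums_def)
  moreover have "continuous_on {a..b} (\<lambda>s. suminf (\<lambda>n. c n * (r * u s) ^ n))"
    by (rule uniform_limit_theorem[OF _ lim]) (use cont in auto)
  ultimately show thesis using that J by blast
qed

section \<open>Expansions for large and small parameter\<close>

text \<open>Although the sine only changes sign under s -> s + 1, \<open>jensen_mean\<close> is even
  in its second argument and hence has period 1; a half-period shift then exchanges cosine and
  sine.\<close>

lemma mahler_m_eqI:
  assumes "\<alpha> \<ge> 1" and J: "((\<lambda>s. jensen_mean \<alpha> (4 * sin (pi * s))) has_integral J) {0..1}"
  shows "mahler_m \<alpha> = J"
proof -
  have "jensen_mean \<alpha> (4 * sin (pi * (s + 1))) = jensen_mean \<alpha> (4 * sin (pi * s))" for s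
    by (simp add: jensen_mean_def distrib_left power_mult_distrib)
  from has_integral_periodic_shift[OF this J, of "1/2"]
  have "((\<lambda>s. jensen_mean \<alpha> (4 * sin (pi * (s + 1/2)))) has_integral J) {0..1}" .
  moreover have "sin (pi * (s + 1/2)) = cos (pi * s)" for s
    by (simp add: distrib_left sin_add)
  ultimately have "((\<lambda>s. jensen_mean \<alpha> (4 * cos (pi * s))) has_integral J) {0..1}" by simp
  then have "has_mean (\<lambda>s. jensen_mean \<alpha> (4 * cos (pi * s))) J"
  proof (rule has_mean_bounded_above[rotated])
    show "(\<lambda>s. jensen_mean \<alpha> (4 * cos (pi * s))) \<in> borel_measurable borel"
      unfolding jensen_mean_def by measurable
    show "jensen_mean \<alpha> (4 * cos (pi * s)) \<le> ln \<alpha> + ln 2" for s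
    proof (cases "\<bar>4 * cos (pi * s)\<bar> \<le> \<bar>\<alpha>\<bar>")
      case True
      have "sqrt (\<alpha>\<^sup>2 - (4 * cos (pi * s))\<^sup>2) \<le> sqrt (\<alpha>\<^sup>2)" by (rule real_sqrt_le_mono) simp
      then have le: "(\<alpha> + sqrt (\<alpha>\<^sup>2 - (4 * cos (pi * s))\<^sup>2)) / 2 \<le> \<alpha>" using assms by simp
      have "\<alpha>\<^sup>2 \<ge> (4 * cos (pi * s))\<^sup>2" using True abs_le_square_iff by blast
      then have "sqrt (\<alpha>\<^sup>2 - (4 * cos (pi * s))\<^sup>2) \<ge> 0" by simp
      then have "(\<alpha> + sqrt (\<alpha>\<^sup>2 - (4 * cos (pi * s))\<^sup>2)) / 2 > 0" using assms by (intro divide_pos_pos add_pos_nonneg) auto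
      with le have "ln ((\<alpha> + sqrt (\<alpha>\<^sup>2 - (4 * cos (pi * s))\<^sup>2)) / 2) \<le> ln \<alpha>" by (intro ln_mono)
      moreover have "ln (2::real) \<ge> 0" by simp
      ultimately show ?thesis unfolding jensen_mean_def using True assms by (simp only: if_True)
    next
      case False
      have "\<bar>4 * cos (pi * s)\<bar> \<le> 4" using abs_cos_le_one[of "pi * s"] by (simp add: abs_mult)
      then have "ln (\<bar>4 * cos (pi * s)\<bar> / 2) \<le> ln 2" using False assms by (intro ln_mono) auto
      moreover have "ln \<alpha> \<ge> 0" using assms by simp
      ultimately show ?thesis unfolding jensen_mean_def using False by (simp only: if_False)
    qed
  qed
  from has_meanD(2)[OF this] show ?thesis unfolding mahler_m_jensen[OF assms(1)] .
qed

lemma sin_squared_has_integral: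
  assumes "b = 1 \<or> b = 1/2"
  shows "((\<lambda>s. (sin (pi * s))\<^sup>2 ^ n) has_integral cbinom n * b) {0..b}"
proof (rule has_integral_sin_power)
  show "sin (pi * b) * cos (pi * b) = 0"
  proof (cases "b = 1")
    case False
    then have "pi * b = pi / 2" using assms by auto
    then have "cos (pi * b) = 0" by (simp only: cos_pi_half)
    then show ?thesis by simp
  qed simp
qed (use assms in auto)

lemma mahler_m_large:
  assumes "\<alpha> > 4"
  shows "(\<lambda>n. cbinom (Suc n) / (2 * (real n + 1)) * ((4 / \<alpha>)\<^sup>2) ^ Suc n * cbinom (Suc n)) sums (ln \<alpha> - mahler_m \<alpha>)"
proof -
  define k where "k = 4 / \<alpha>"
  have k: "0 < k" "k < 1" using assms by (auto simp: k_def)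
  \<comment> \<open>The value 0 at n = 0 pads the logarithmic series, which starts at n = 1.\<close>
  define c where "c n = (if n = 0 then 0 else cbinom n / (2 * real n))" for n
  have c_le: "\<bar>c n\<bar> \<le> 1" for n
    unfolding c_def using abs_cbinom_div_le_1[of "2 * real n" n] by simp
  have k2: "0 \<le> k\<^sup>2" "k\<^sup>2 < 1" using k by (auto simp: abs_square_less_1)
  obtain J where J: "((\<lambda>s. suminf (\<lambda>n. c n * (k\<^sup>2 * (sin (pi * s))\<^sup>2) ^ n)) has_integral J) {0..1}"
    and Js: "(\<lambda>n. c n * (k\<^sup>2) ^ n * (cbinom n * 1)) sums J"
    by (rule has_integral_power_series[OF c_le k2, where a = 0 and b = 1 and u = "\<lambda>s. (sin (pi * s))\<^sup>2" and m = "\<lambda>n. cbinom n * 1"])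
      (use sin_squared_has_integral[of 1] in \<open>auto intro!: continuous_intros simp: abs_square_le_1\<close>)
  have eq: "jensen_mean \<alpha> (4 * sin (pi * s)) = ln \<alpha> - suminf (\<lambda>n. c n * (k\<^sup>2 * (sin (pi * s))\<^sup>2) ^ n)" for s
  proof -
    define x where "x = k\<^sup>2 * (sin (pi * s))\<^sup>2"
    have "(sin (pi * s))\<^sup>2 \<le> 1" by (simp add: abs_square_le_1)
    then have "x \<le> k\<^sup>2 * 1" unfolding x_def using k2 by (intro mult_left_mono)
    then have x: "0 \<le> x" "x < 1" using k2 by (auto simp: x_def)
    have "(\<lambda>n. c (Suc n) * x ^ Suc n) sums (- ln ((1 + sqrt (1 - x)) / 2))"
      using cbinom_ln_series[of x] x by (simp add: c_def add_ac)
    then have "(\<lambda>n. c n * x ^ n) sums (- ln ((1 + sqrt (1 - x)) / 2))"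
      by (subst (asm) sums_Suc_iff) (simp add: c_def)
    then have 1: "suminf (\<lambda>n. c n * x ^ n) = - ln ((1 + sqrt (1 - x)) / 2)" by (simp add: sums_iff)
    have "\<alpha>\<^sup>2 - (4 * sin (pi * s))\<^sup>2 = \<alpha>\<^sup>2 * (1 - x)"
      using assms by (simp add: x_def k_def field_simps power_mult_distrib power_divide)
    then have "sqrt (\<alpha>\<^sup>2 - (4 * sin (pi * s))\<^sup>2) = \<alpha> * sqrt (1 - x)"
      using assms by (simp add: real_sqrt_mult)
    then have 2: "(\<alpha> + sqrt (\<alpha>\<^sup>2 - (4 * sin (pi * s))\<^sup>2)) / 2 = \<alpha> * ((1 + sqrt (1 - x)) / 2)"
      by (simp add: algebra_simps)
    have "\<bar>4 * sin (pi * s)\<bar> \<le> 4" using abs_sin_le_one[of "pi * s"] by (simp add: abs_mult)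
    then have "\<bar>4 * sin (pi * s)\<bar> \<le> \<bar>\<alpha>\<bar>" "\<bar>\<alpha>\<bar> = \<alpha>" using assms by linarith+
    then have "jensen_mean \<alpha> (4 * sin (pi * s)) = ln (\<alpha> * ((1 + sqrt (1 - x)) / 2))"
      unfolding jensen_mean_def by (simp only: if_True 2)
    also have "\<dots> = ln \<alpha> + ln ((1 + sqrt (1 - x)) / 2)"
      using x assms by (intro ln_mult_pos divide_pos_pos add_pos_nonneg) auto
    finally have "jensen_mean \<alpha> (4 * sin (pi * s)) = ln \<alpha> + ln ((1 + sqrt (1 - x)) / 2)" .
    with 1 show ?thesis by (simp add: x_def)
  qed
  have "((\<lambda>s. jensen_mean \<alpha> (4 * sin (pi * s))) has_integral (ln \<alpha> - J)) {0..1}"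
    unfolding eq using has_integral_diff[OF _ J, of "\<lambda>_. ln \<alpha>" "ln \<alpha>"] has_integral_const_real[of "ln \<alpha>" 0 1] by simp
  then have "mahler_m \<alpha> = ln \<alpha> - J" using assms by (intro mahler_m_eqI) auto
  moreover have "(\<lambda>n. c (Suc n) * (k\<^sup>2) ^ Suc n * (cbinom (Suc n) * 1)) sums J"
    using Js by (subst sums_Suc_iff) (simp add: c_def)
  ultimately show ?thesis by (simp add: c_def k_def add_ac)
qed

lemma continuous_on_mult_ln_sin:
  assumes "0 < b" "b < 1"
  shows "continuous_on {0..b} (\<lambda>s. s * ln (sin (pi * s)))"
  unfolding continuous_on_def
proof
  fix s assume s: "s \<in> {0..b}"
  show "((\<lambda>s. s * ln (sin (pi * s))) \<longlongrightarrow> s * ln (sin (pi * s))) (at s within {0..b})"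
  proof (cases "s = 0")
    case True
    have "((\<lambda>s::real. s * ln (sin (pi * s))) \<longlongrightarrow> 0) (at_right 0)" by real_asymp
    then show ?thesis using True assms by (simp add: at_within_Icc_at_right)
  next
    case False
    then have "sin (pi * s) > 0" using s assms by (intro sin_gt_zero) auto
    then show ?thesis by (auto intro!: tendsto_intros)
  qed
qed

text \<open>With \<alpha> = 4k the Jensen mean changes its formula at |sin(pi s)| = k. Subtracting
  \<open>ln_2sin\<close>, of mean 0, leaves \<open>W\<close>, which is arcosh(k / |sin(pi s)|) where
  0 < |sin(pi s)| < k and 0 elsewhere. The integral of \<open>W\<close> up to the switching point
  equals that of arcsin(k sin(pi s)) / sin(pi s) over {0..1/2}, a power series in the squared
  sine.\<close>

lemma mahler_m_small:
  assumes "1/4 \<le> k" "k < 1"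
  shows "(\<lambda>n. cbinom n / (2 * real n + 1) * (k\<^sup>2) ^ n * cbinom n * k) sums mahler_m (4 * k)"
proof -
  have k: "0 < k" "k < 1" using assms by auto
  define c where "c n = cbinom n / (2 * real n + 1)" for n
  have c_le: "\<bar>c n\<bar> \<le> 1" for n
    unfolding c_def by (rule abs_cbinom_div_le_1) simp
  have k2: "0 \<le> k\<^sup>2" "k\<^sup>2 < 1" using k by (auto simp: abs_square_less_1)
  \<comment> \<open>The series rather than the quotient arcsin(k sin(pi s)) / sin(pi s): it has the
    right value k at s = 0 and is continuous.\<close>
  define v where "v s = k * suminf (\<lambda>n. c n * (k\<^sup>2 * (sin (pi * s))\<^sup>2) ^ n)" for s
  obtain J where J: "((\<lambda>s. suminf (\<lambda>n. c n * (k\<^sup>2 * (sin (pi * s))\<^sup>2) ^ n)) has_integral J) {0..1/2}"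
    and Js: "(\<lambda>n. c n * (k\<^sup>2) ^ n * (cbinom n * (1/2))) sums J"
    and Jc: "continuous_on {0..1/2} (\<lambda>s. suminf (\<lambda>n. c n * (k\<^sup>2 * (sin (pi * s))\<^sup>2) ^ n))"
    by (rule has_integral_power_series[OF c_le k2, where a = 0 and b = "1/2" and u = "\<lambda>s. (sin (pi * s))\<^sup>2" and m = "\<lambda>n. cbinom n * (1/2)"])
      (use sin_squared_has_integral[of "1/2"] in \<open>auto intro!: continuous_intros simp: abs_square_le_1\<close>)
  have v_int: "(v has_integral k * J) {0..1/2}" and v_cont: "continuous_on {0..1/2} v"
    unfolding v_def[abs_def] using has_integral_mult_right[OF J] Jc by (auto intro!: continuous_intros)
  have v_eq: "v s * sin (pi * s) = arcsin (k * sin (pi * s))" for s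
  proof -
    have "\<bar>k * sin (pi * s)\<bar> = k * \<bar>sin (pi * s)\<bar>" using k by (simp add: abs_mult)
    also have "\<dots> \<le> k * 1" using k by (intro mult_left_mono) auto
    also have "\<dots> < 1" using k by simp
    finally have "\<bar>k * sin (pi * s)\<bar> < 1" .
    from arcsin_series[OF this] have "(\<lambda>n. c n * (k\<^sup>2 * (sin (pi * s))\<^sup>2) ^ n * (k * sin (pi * s))) sums arcsin (k * sin (pi * s))"
      by (simp add: c_def power_mult_distrib)
    moreover have "(\<lambda>n. c n * (k\<^sup>2 * (sin (pi * s))\<^sup>2) ^ n) sums (suminf (\<lambda>n. c n * (k\<^sup>2 * (sin (pi * s))\<^sup>2) ^ n))"
    proof (intro summable_sums summable_bounded_coeffs c_le)
      have "k\<^sup>2 * (sin (pi * s))\<^sup>2 \<le> k\<^sup>2 * 1" using k2 by (intro mult_left_mono) (auto simp: abs_square_le_1)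
      then show "\<bar>k\<^sup>2 * (sin (pi * s))\<^sup>2\<bar> < 1" using k2 by simp
    qed
    from sums_mult2[OF this, of "k * sin (pi * s)"]
    have "(\<lambda>n. c n * (k\<^sup>2 * (sin (pi * s))\<^sup>2) ^ n * (k * sin (pi * s))) sums (v s * sin (pi * s))"
      by (simp add: v_def mult_ac)
    ultimately show ?thesis by (rule sums_unique2[symmetric])
  qed
  define V where "V x = integral {0..x} v" for x
  define s0 where "s0 = arcsin k / pi"
  have s0: "0 < s0" "s0 < 1/2"
    using arcsin_less_mono[of 0 k] arcsin_less_mono[of k 1] k by (auto simp: s0_def field_simps)
  have sin_s0: "sin (pi * s0) = k" using k by (simp add: s0_def)
  have sin_less: "0 < sin (pi * s)" "sin (pi * s) < k" if "0 < s" "s < s0" for s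
  proof -
    show "0 < sin (pi * s)" using that s0 by (intro sin_gt_zero) auto
    have "pi * s < pi * s0" "pi * s0 \<le> pi / 2" using that s0 by (auto simp: field_simps)
    then have "sin (pi * s) < sin (pi * s0)" using that by (intro sin_monotone_2pi) (auto intro: order_trans[of _ 0])
    then show "sin (pi * s) < k" by (simp add: sin_s0)
  qed
  have sin_ge: "k \<le> sin (pi * s)" if "s0 \<le> s" "s \<le> 1/2" for s
  proof -
    have "pi * s0 \<le> pi * s" "pi * s \<le> pi / 2" "0 \<le> pi * s0" using that s0 by (auto simp: field_simps)
    then have "sin (pi * s0) \<le> sin (pi * s)" using pi_ge_zero by (intro sin_monotone_2pi_le) linarith+
    then show ?thesis by (simp add: sin_s0)
  qed
  define \<phi> where "\<phi> s = arcsin (sin (pi * s) / k) / pi" for s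
  define W where "W s = (if 0 < \<bar>sin (pi * s)\<bar> \<and> \<bar>sin (pi * s)\<bar> < k
     then ln ((k + sqrt (k\<^sup>2 - (sin (pi * s))\<^sup>2)) / \<bar>sin (pi * s)\<bar>) else 0)" for s
  \<comment> \<open>\<open>P\<close> is an antiderivative of \<open>W\<close> on \<open>{0<..<s0}\<close>. It comes from the substitution
     \<open>sin (pi * s) = k * sin (pi * \<phi> s)\<close> followed by an integration by parts.\<close>
  define P where "P s = s * ln (k + sqrt (k\<^sup>2 - (sin (pi * s))\<^sup>2)) - s * ln (sin (pi * s)) + V (\<phi> s)" for s
  have sin_le: "0 \<le> sin (pi * s)" "sin (pi * s) \<le> k" if "s \<in> {0..s0}" for s
    using that sin_less[of s] sin_s0 k by (cases "s = 0"; cases "s = s0"; force)+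
  have \<phi>_range: "\<phi> s \<in> {0..1/2}" if "s \<in> {0..s0}" for s
  proof -
    have "0 \<le> sin (pi * s) / k" "sin (pi * s) / k \<le> 1" using sin_le[OF that] k by (auto simp: divide_le_eq)
    then have "0 \<le> arcsin (sin (pi * s) / k)" "arcsin (sin (pi * s) / k) \<le> pi / 2"
      using arcsin_le_mono[of 0 "sin (pi * s) / k"] arcsin_bounded[of "sin (pi * s) / k"] by auto
    then show ?thesis by (auto simp: \<phi>_def field_simps)
  qed
  have V_cont: "continuous_on {0..1/2} V"
    unfolding V_def[abs_def] using v_int by (intro indefinite_integral_continuous_1) (auto simp: has_integral_integrable)
  have P_cont: "continuous_on {0..s0} P"
  proof -
    have "continuous_on {0..s0} (\<lambda>s. V (\<phi> s))"
    proof (rule continuous_on_compose2[OF V_cont])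
      show "continuous_on {0..s0} \<phi>"
        unfolding \<phi>_def[abs_def] using sin_le k by (intro continuous_intros) (auto simp: divide_le_eq le_divide_eq intro: order_trans[of _ 0])
    qed (use \<phi>_range in auto)
    moreover have "continuous_on {0..s0} (\<lambda>s. s * ln (sin (pi * s)))"
      using s0 by (intro continuous_on_mult_ln_sin) auto
    moreover have "continuous_on {0..s0} (\<lambda>s. s * ln (k + sqrt (k\<^sup>2 - (sin (pi * s))\<^sup>2)))"
    proof (intro continuous_intros ballI)
      fix s assume s: "s \<in> {0..s0}"
      have "(sin (pi * s))\<^sup>2 \<le> k\<^sup>2" using sin_le[OF s] by (intro power_mono) auto
      then have "sqrt (k\<^sup>2 - (sin (pi * s))\<^sup>2) \<ge> 0" by simp
      then show "k + sqrt (k\<^sup>2 - (sin (pi * s))\<^sup>2) \<noteq> 0" using k by linarith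
    qed
    ultimately show ?thesis unfolding P_def[abs_def] by (intro continuous_on_add continuous_on_diff)
  qed
  have P_deriv: "(P has_field_derivative W s) (at s)" if s: "0 < s" "s < s0" for s
  proof -
    define S where "S = sin (pi * s)"
    define C where "C = pi * cos (pi * s)"
    define r where "r = sqrt (k\<^sup>2 - S\<^sup>2)"
    have S: "0 < S" "S < k" using sin_less[OF s] by (auto simp: S_def)
    have "S\<^sup>2 < k\<^sup>2" using S by (intro power_strict_mono) auto
    then have r: "r > 0" "r\<^sup>2 = k\<^sup>2 - S\<^sup>2" by (auto simp: r_def)
    have dS: "((\<lambda>s. sin (pi * s)) has_field_derivative C) (at s)"
      unfolding C_def by (auto intro!: derivative_eq_intros)
    have "((\<lambda>s. k\<^sup>2 - (sin (pi * s))\<^sup>2) has_field_derivative - (2 * S * C)) (at s)"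
      using DERIV_diff[OF DERIV_const DERIV_power[OF dS, of 2], of "k\<^sup>2"] by (simp add: S_def mult_ac)
    from DERIV_chain2[OF DERIV_real_sqrt this] have "((\<lambda>s. sqrt (k\<^sup>2 - (sin (pi * s))\<^sup>2)) has_field_derivative
        inverse r / 2 * (- (2 * S * C))) (at s)"
      using r by (simp add: r_def S_def)
    from DERIV_add[OF DERIV_const this, of k]
    have "((\<lambda>s. k + sqrt (k\<^sup>2 - (sin (pi * s))\<^sup>2)) has_field_derivative - (S * C / r)) (at s)"
      by (simp add: field_simps)
    moreover have kr: "k + sqrt (k\<^sup>2 - (sin (pi * s))\<^sup>2) = k + r" by (simp add: r_def S_def)
    ultimately have "((\<lambda>s. ln (k + sqrt (k\<^sup>2 - (sin (pi * s))\<^sup>2))) has_field_derivative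
        1 / (k + sqrt (k\<^sup>2 - (sin (pi * s))\<^sup>2)) * - (S * C / r)) (at s)"
      using r k by (intro DERIV_chain2[OF DERIV_ln_divide]) (simp_all only: kr add_pos_pos)
    then have "((\<lambda>s. ln (k + sqrt (k\<^sup>2 - (sin (pi * s))\<^sup>2))) has_field_derivative 1 / (k + r) * - (S * C / r)) (at s)"
      by (simp only: kr)
    from DERIV_mult[OF DERIV_ident this]
    have d1: "((\<lambda>s. s * ln (k + sqrt (k\<^sup>2 - (sin (pi * s))\<^sup>2))) has_field_derivative
        ln (k + r) + s * (1 / (k + r) * - (S * C / r))) (at s)"
      by (simp add: r_def S_def mult_ac)
    have "((\<lambda>s. ln (sin (pi * s))) has_field_derivative 1 / sin (pi * s) * C) (at s)"
      using S by (intro DERIV_chain2[OF DERIV_ln_divide] dS) (simp add: S_def)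
    then have "((\<lambda>s. ln (sin (pi * s))) has_field_derivative 1 / S * C) (at s)"
      by (simp only: S_def)
    from DERIV_mult[OF DERIV_ident this]
    have d2: "((\<lambda>s. s * ln (sin (pi * s))) has_field_derivative ln S + s * (1 / S * C)) (at s)"
      by (simp add: S_def mult_ac)
    have Sk: "0 < S / k" "S / k < 1" using S k by auto
    have \<phi>s: "\<phi> s \<in> {0<..<1/2}"
    proof -
      have "0 < arcsin (S / k)" "arcsin (S / k) < pi / 2"
        using arcsin_less_mono[of 0 "S / k"] arcsin_less_mono[of "S / k" 1] Sk by auto
      then show ?thesis by (auto simp: \<phi>_def S_def field_simps)
    qed
    have sin_\<phi>: "sin (pi * \<phi> s) = S / k" using Sk by (simp add: \<phi>_def S_def)
    \<comment> \<open>Along \<phi> the integrand \<open>v\<close> becomes elementary, since k sin(pi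
      \<phi> s) = sin(pi s) and the arcsine undoes the sine.\<close>
    have "v (\<phi> s) * (S / k) = arcsin S" using v_eq[of "\<phi> s"] k unfolding sin_\<phi> by simp
    also have "arcsin S = pi * s" unfolding S_def using s s0 by (intro arcsin_sin) (auto intro: order_trans[of _ 0] simp: field_simps)
    finally have v_\<phi>: "v (\<phi> s) = pi * s * k / S" using S k by (simp add: field_simps)
    have "(V has_field_derivative v (\<phi> s)) (at (\<phi> s) within {0..1/2})"
      unfolding V_def[abs_def] using \<phi>s by (intro integral_has_real_derivative v_cont) auto
    then have dV: "(V has_field_derivative v (\<phi> s)) (at (\<phi> s))"
      using \<phi>s at_within_interior[of "\<phi> s" "{0..1/2}"] by (simp add: interior_atLeastAtMost_real)
    have "sqrt (1 - (S / k)\<^sup>2) = r / k"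
    proof -
      have "1 - (S / k)\<^sup>2 = (r / k)\<^sup>2" using r(2) k by (simp add: power_divide field_simps)
      then show ?thesis using r k by simp
    qed
    then have "(arcsin has_field_derivative inverse (r / k)) (at (S / k))"
      using DERIV_arcsin[of "S / k"] Sk by simp
    moreover have "((\<lambda>s. sin (pi * s) / k) has_field_derivative C / k) (at s)"
      by (rule DERIV_cdivide[OF dS])
    ultimately have "((\<lambda>s. arcsin (sin (pi * s) / k)) has_field_derivative inverse (r / k) * (C / k)) (at s)"
      unfolding S_def by (rule DERIV_chain2)
    from DERIV_cdivide[OF this, of pi] have "(\<phi> has_field_derivative inverse (r / k) * (C / k) / pi) (at s)"
      unfolding \<phi>_def[abs_def] .
    from DERIV_chain2[OF dV this] have d3: "((\<lambda>s. V (\<phi> s)) has_field_derivative v (\<phi> s) * (inverse (r / k) * (C / k) / pi)) (at s)" .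
    have "(P has_field_derivative (ln (k + r) + s * (1 / (k + r) * - (S * C / r))) - (ln S + s * (1 / S * C))
        + v (\<phi> s) * (inverse (r / k) * (C / k) / pi)) (at s)"
      unfolding P_def[abs_def] by (intro DERIV_add DERIV_diff d1 d2 d3)
    also have "(ln (k + r) + s * (1 / (k + r) * - (S * C / r))) - (ln S + s * (1 / S * C))
        + v (\<phi> s) * (inverse (r / k) * (C / k) / pi) = ln (k + r) - ln S"
    proof -
      \<comment> \<open>This identity cancels all terms with a factor s in the derivative of
        \<open>P\<close>, leaving the difference of logarithms.\<close>
      have "1 / (k + r) * (S / r) + 1 / S = k / (S * r)"
      proof -
        have nz: "k + r \<noteq> 0" "r \<noteq> 0" "S \<noteq> 0" using r k S by linarith+
        have e: "S * S + r * (k + r) = k * (k + r)"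
          using r(2) by (simp add: algebra_simps power2_eq_square)
        have "1 / (k + r) * (S / r) + 1 / S = (S * S + r * (k + r)) / ((k + r) * (S * r))"
          using nz by (simp add: divide_simps)
        also have "\<dots> = k / (S * r)" unfolding e using nz by simp
        finally show ?thesis .
      qed
      then have "s * C * (1 / (k + r) * (S / r) + 1 / S) = s * C * (k / (S * r))" by simp
      moreover have "v (\<phi> s) * (inverse (r / k) * (C / k) / pi) = s * C * (k / (S * r))"
        unfolding v_\<phi> using r S k by (simp add: divide_simps)
      ultimately show ?thesis by (simp add: algebra_simps)
    qed
    also have "ln (k + r) - ln S = W s"
      using S r k by (simp add: W_def S_def[symmetric] r_def[symmetric] ln_div)
    finally show ?thesis .
  qed
  \<comment> \<open>Derivatives are available only in the open interval, so continuity of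
    \<open>P\<close> handles the ends. At \<open>s0\<close> the square root is 0, the logarithms
    cancel and \<phi> reaches 1/2; at 0 the factor s removes the logarithms.\<close>
  have "(W has_integral (P s0 - P 0)) {0..s0}"
    by (rule fundamental_theorem_of_calculus_interior)
      (use s0 P_cont P_deriv in \<open>auto simp: has_real_derivative_iff_has_vector_derivative\<close>)
  moreover have "P s0 - P 0 = k * J"
  proof -
    have \<phi>_s0: "\<phi> s0 = 1/2" using k by (simp add: \<phi>_def sin_s0)
    have "V (1/2) = k * J" unfolding V_def using v_int by (rule integral_unique)
    then have "P s0 = k * J" unfolding P_def \<phi>_s0 sin_s0 by simp
    moreover have "P 0 = 0" by (simp add: P_def \<phi>_def V_def)
    ultimately show ?thesis by simp
  qed
  ultimately have 1: "(W has_integral k * J) {0..s0}" by simp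
  have "(W has_integral 0) {s0..1/2}"
  proof (rule has_integral_is_0)
    fix s assume "s \<in> {s0..1/2}"
    with sin_ge[of s] k show "W s = 0" by (simp add: W_def)
  qed
  from has_integral_combine[OF _ _ 1 this] s0 have 2: "(W has_integral k * J) {0..1/2}" by simp
  \<comment> \<open>Evenness and period 1 carry the integral over the first half period to the
    second.\<close>
  have W_minus: "W (- s) = W s" for s by (simp add: W_def)
  have W_per: "W (s + 1) = W s" for s by (simp add: W_def distrib_left)
  from 2 have "((\<lambda>s. W (- s)) has_integral k * J) {-(1/2)..-0}"
    by (subst has_integral_reflect_real)
  then have "(W has_integral k * J) {-(1/2)..0}" by (simp add: W_minus)
  from has_integral_shift_real_ivl[OF this, of "-1"]
  have "((\<lambda>s. W (s + (-1))) has_integral k * J) {1/2..1}" by simp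
  moreover have "W (s + (-1)) = W s" for s using W_per[of "s - 1"] by simp
  ultimately have "(W has_integral k * J) {1/2..1}" by simp
  from has_integral_combine[OF _ _ 2 this] have "(W has_integral (k * J + k * J)) {0..1}" by simp
  moreover have "(ln_2sin has_integral 0) {0..1}" using has_mean_ln_2sin by (simp add: has_mean_def)
  ultimately have "((\<lambda>s. ln_2sin s + W s) has_integral (0 + (k * J + k * J))) {0..1}"
    by (intro has_integral_add)
  then have "((\<lambda>s. jensen_mean (4 * k) (4 * sin (pi * s))) has_integral (0 + (k * J + k * J))) {0..1}"
  proof (rule has_integral_spike[rotated 2])
    show "negligible {s. sin (pi * s + 0) = 0}" by (rule negligible_sin_zeros) simp
    fix s assume "s \<in> {0..1} - {s. sin (pi * s + 0) = 0}"
    then have nz: "sin (pi * s) \<noteq> 0" by simp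
    show "jensen_mean (4 * k) (4 * sin (pi * s)) = ln_2sin s + W s"
    proof (cases "\<bar>sin (pi * s)\<bar> \<le> k")
      case True
      define S where "S = \<bar>sin (pi * s)\<bar>"
      have S: "0 < S" "S \<le> k" using nz True by (auto simp: S_def)
      have S2: "S\<^sup>2 \<le> k\<^sup>2" using S by (intro power_mono) auto
      define r where "r = sqrt (k\<^sup>2 - S\<^sup>2)"
      have r: "r \<ge> 0" using S2 by (simp add: r_def)
      have "sqrt ((4 * k)\<^sup>2 - (4 * S)\<^sup>2) = 4 * r"
      proof -
        have "(4 * k)\<^sup>2 - (4 * S)\<^sup>2 = 4\<^sup>2 * (k\<^sup>2 - S\<^sup>2)" by (simp add: power_mult_distrib)
        then show ?thesis by (simp only: real_sqrt_mult r_def) simp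
      qed
      moreover have "(4 * sin (pi * s))\<^sup>2 = (4 * S)\<^sup>2" by (simp add: S_def power_mult_distrib)
      ultimately have "jensen_mean (4 * k) (4 * sin (pi * s)) = ln ((4 * k + 4 * r) / 2)"
        using True k by (simp add: jensen_mean_def abs_mult)
      also have "(4 * k + 4 * r) / 2 = (2 * S) * ((k + r) / S)" using S by (simp add: field_simps)
      also have "ln \<dots> = ln (2 * S) + ln ((k + r) / S)"
        using S r k by (intro ln_mult_pos) auto
      also have "ln (2 * S) = ln_2sin s" by (simp add: ln_2sin_def S_def abs_mult)
      also have "ln ((k + r) / S) = W s"
      proof (cases "S = k")
        case True
        then show ?thesis using S k by (simp add: W_def r_def S_def[symmetric])
      next
        case False
        moreover have "(sin (pi * s))\<^sup>2 = S\<^sup>2" by (simp add: S_def)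
        ultimately show ?thesis using S by (simp add: W_def r_def S_def[symmetric])
      qed
      finally show ?thesis .
    next
      case False
      then have "jensen_mean (4 * k) (4 * sin (pi * s)) = ln (\<bar>4 * sin (pi * s)\<bar> / 2)"
        using k by (simp add: jensen_mean_def abs_mult)
      also have "\<bar>4 * sin (pi * s)\<bar> / 2 = \<bar>2 * sin (pi * s)\<bar>" by (simp add: abs_mult)
      finally show ?thesis using False by (simp add: ln_2sin_def W_def)
    qed
  qed
  then have "mahler_m (4 * k) = 0 + (k * J + k * J)" using assms by (intro mahler_m_eqI) auto
  then have "mahler_m (4 * k) = 2 * k * J" by simp
  moreover have "(\<lambda>n. 2 * k * (c n * (k\<^sup>2) ^ n * (cbinom n * (1/2)))) sums (2 * k * J)"
    by (rule sums_mult[OF Js])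
  moreover have "2 * k * (c n * (k\<^sup>2) ^ n * (cbinom n * (1/2))) = c n * (k\<^sup>2) ^ n * cbinom n * k" for n
    by simp
  ultimately show ?thesis by (simp only: c_def)
qed

section \<open>The series as combinations of Mahler measures\<close>

text \<open>Derived from the expansions alone, without the WZ evaluation: the series misses the
  value in (ii) by exactly the defect of the Mahler measure identity, which is the substance of the
  equivalence.\<close>

lemma series_term_6_1_6_sums_mahler: "(\<lambda>n. series_term 6 1 6 (Suc n)) sums (3 * ln 2 - 2 + (4 * mahler_m 2 - mahler_m 8))"
proof -
  have "(\<lambda>n. cbinom n / (2 * real n + 1) * (1/4) ^ n * cbinom n * (1/2)) sums mahler_m 2"
    using mahler_m_small[of "1/2"] by (simp add: power_divide)
  \<comment> \<open>The dropped term at n = 0 is k = 1/2; after multiplication by 4 it is the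
    constant 2 of (ii).\<close>
  then have 1: "(\<lambda>n. cbinom (Suc n) / (2 * real (Suc n) + 1) * (1/4) ^ Suc n * cbinom (Suc n) * (1/2)) sums (mahler_m 2 - 1/2)"
    by (subst sums_Suc_iff) simp
  have 2: "(\<lambda>n. cbinom (Suc n) / (2 * (real n + 1)) * (1/4) ^ Suc n * cbinom (Suc n)) sums (3 * ln 2 - mahler_m 8)"
  proof -
    have "ln 8 = 3 * ln (2::real)" using ln_realpow[of 2 3] by simp
    then show ?thesis using mahler_m_large[of 8] by (simp add: power_divide)
  qed
  have "4 * (cbinom (Suc n) / (2 * real (Suc n) + 1) * (1/4) ^ Suc n * cbinom (Suc n) * (1/2))
      + cbinom (Suc n) / (2 * (real n + 1)) * (1/4) ^ Suc n * cbinom (Suc n) = series_term 6 1 6 (Suc n)" for n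
  proof -
    have "4 * (b / (2 * x + 1) * q * b * (1/2)) + b / (2 * x) * q * b
        = (6 * x + 1) / ((2 * x) * (2 * x + 1)) * b\<^sup>2 * q"
      if "x > 0" for x b q :: real
    proof -
      have "x \<noteq> 0" "2 * x + 1 \<noteq> 0" using that by linarith+
      then show ?thesis by (simp add: divide_simps power2_eq_square) (simp add: algebra_simps power2_eq_square)
    qed
    from this[of "real n + 1" "cbinom (Suc n)" "(1/4) ^ Suc n"] show ?thesis
      by (simp add: series_term_eq_cbinom add_ac)
  qed
  with sums_add[OF sums_mult[OF 1, of 4] 2] show ?thesis by (simp add: algebra_simps)
qed

lemma series_term_15_2_8_sums_mahler: "(\<lambda>n. series_term 15 2 8 (Suc n)) sums (8 * ln 2 - 11/2 + 2 * (11 * mahler_m 1 - mahler_m 16))"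
proof -
  have "(\<lambda>n. cbinom n / (2 * real n + 1) * (1/16) ^ n * cbinom n * (1/4)) sums mahler_m 1"
    using mahler_m_small[of "1/4"] by (simp add: power_divide)
  then have 1: "(\<lambda>n. cbinom (Suc n) / (2 * real (Suc n) + 1) * (1/16) ^ Suc n * cbinom (Suc n) * (1/4)) sums (mahler_m 1 - 1/4)"
    by (subst sums_Suc_iff) simp
  have 2: "(\<lambda>n. cbinom (Suc n) / (2 * (real n + 1)) * (1/16) ^ Suc n * cbinom (Suc n)) sums (4 * ln 2 - mahler_m 16)"
  proof -
    have "ln 16 = 4 * ln (2::real)" using ln_realpow[of 2 4] by simp
    then show ?thesis using mahler_m_large[of 16] by (simp add: power_divide)
  qed
  \<comment> \<open>The weights 22 and 2 are twice the ratio 11 : 1 of the Mahler measures, which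
    clears the fraction in 15n/2 + 1.\<close>
  have "22 * (cbinom (Suc n) / (2 * real (Suc n) + 1) * (1/16) ^ Suc n * cbinom (Suc n) * (1/4))
      + 2 * (cbinom (Suc n) / (2 * (real n + 1)) * (1/16) ^ Suc n * cbinom (Suc n)) = series_term 15 2 8 (Suc n)" for n
  proof -
    have "22 * (b / (2 * x + 1) * q * b * (1/4)) + 2 * (b / (2 * x) * q * b)
        = (15 * x + 2) / ((2 * x) * (2 * x + 1)) * b\<^sup>2 * q"
      if "x > 0" for x b q :: real
    proof -
      have "x \<noteq> 0" "2 * x + 1 \<noteq> 0" using that by linarith+
      then show ?thesis by (simp add: divide_simps power2_eq_square) (simp add: algebra_simps power2_eq_square)
    qed
    from this[of "real n + 1" "cbinom (Suc n)" "(1/16) ^ Suc n"] show ?thesis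
      by (simp add: series_term_eq_cbinom add_ac)
  qed
  with sums_add[OF sums_mult[OF 1, of 22] sums_mult[OF 2, of 2]] show ?thesis by (simp add: algebra_simps)
qed

theorem theorem1:
  shows "(summable (\<lambda>n. series_term 4 1 4 (Suc n)) \<and>
          summable (\<lambda>n. series_term 6 1 6 (Suc n)) \<and>
          summable (\<lambda>n. series_term 15 2 8 (Suc n))) \<and>
         2 * ln 2 = 1 + suminf (\<lambda>n. series_term 4 1 4 (Suc n)) \<and>
         3 * ln 2 = 2 + suminf (\<lambda>n. series_term 6 1 6 (Suc n)) \<and>
         8 * ln 2 = 11 / 2 + suminf (\<lambda>n. series_term 15 2 8 (Suc n)) \<and>
         (3 * ln 2 = 2 + suminf (\<lambda>n. series_term 6 1 6 (Suc n)) \<longleftrightarrow> 4 * mahler_m 2 = mahler_m 8) \<and>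
         (8 * ln 2 = 11 / 2 + suminf (\<lambda>n. series_term 15 2 8 (Suc n)) \<longleftrightarrow> 11 * mahler_m 1 = mahler_m 16) \<and>
         4 * mahler_m 2 = mahler_m 8 \<and>
         11 * mahler_m 1 = mahler_m 16"
proof -
  have "4 * mahler_m 2 = mahler_m 8" using sums_unique2[OF series_term_6_1_6_sums series_term_6_1_6_sums_mahler] by simp
  moreover have "11 * mahler_m 1 = mahler_m 16" using sums_unique2[OF series_term_15_2_8_sums series_term_15_2_8_sums_mahler] by simp
  ultimately show ?thesis
    using series_term_4_1_4_sums series_term_6_1_6_sums series_term_15_2_8_sums by (simp add: sums_iff)
qed

end
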